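(* Let $k$ be a perfect field and let $A=k[x,y,t,s]/(x^2t+y^2s+xy)$, which is an integral domain. Then the normalization $\overline{A}$ of $A$ is given as an affine ring by $$\overline{A}\cong k[X,Y,T,S,U]/(YU-XT,\; XU+YS+X,\; U^2+U+TS).$$
   Context: The normalization $\overline{A}$ of an integral domain $A$ is the integral closure of $A$ in its field of fractions. The isomorphism is one of $k$-algebras. *)

theory Defs
  imports
    "HOL-Algebra.Algebra"
    "HOL-Algebra.Algebraic_Closure_Type"
    "HOL-Library.Poly_Mapping"
begin

section \<open>Perfect fields\<close>

text \<open>Every irreducible polynomial has only simple roots in an algebraic closure.\<close>

definition perfect_field :: "'k::field itself \<Rightarrow> bool" where
  "perfect_field _ \<longleftrightarrow>
     (\<forall>p :: 'k poly. Factorial_Ring.irreducible p \<longrightarrow> Polynomial.rsquarefree (map_poly to_ac p))"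


section \<open>Affine algebras over a field\<close>

text \<open>An exponent vector is a finitely supported function from variables to \<^typ>\<open>nat\<close>, a
  polynomial a finitely supported function from exponent vectors to coefficients; the ring
  operations on \<^term>\<open>p :: ('v \<Rightarrow>\<^sub>0 nat) \<Rightarrow>\<^sub>0 'k::field\<close> are the convolution operations of the
  library.\<close>

type_synonym ('v, 'k) mpoly = "('v \<Rightarrow>\<^sub>0 nat) \<Rightarrow>\<^sub>0 'k"

definition Var :: "'v \<Rightarrow> ('v, 'k::field) mpoly" where
  "Var v = Poly_Mapping.single (Poly_Mapping.single v 1) 1"

definition Const :: "'k::field \<Rightarrow> ('v, 'k) mpoly" where
  "Const c = Poly_Mapping.single 0 c"

abbreviation mpoly_ring :: "('v, 'k::field) mpoly ring" where
  "mpoly_ring \<equiv> ring_of_type_algebra"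

definition affine_algebra :: "('v, 'k::field) mpoly set \<Rightarrow> ('v, 'k) mpoly set ring" where
  "affine_algebra F = mpoly_ring Quot (Idl\<^bsub>mpoly_ring\<^esub> F)"

definition affine_scalar :: "('v, 'k::field) mpoly set \<Rightarrow> 'k \<Rightarrow> ('v, 'k) mpoly set" where
  "affine_scalar F c = (Idl\<^bsub>mpoly_ring\<^esub> F) +>\<^bsub>mpoly_ring\<^esub> Const c"

text \<open>A \<^typ>\<open>'k\<close>-algebra is given by a ring together with its structure map from \<^typ>\<open>'k\<close>.\<close>

definition algebra_isomorphic ::
  "('a, 'c) ring_scheme \<Rightarrow> ('k \<Rightarrow> 'a) \<Rightarrow> ('b, 'd) ring_scheme \<Rightarrow> ('k \<Rightarrow> 'b) \<Rightarrow> bool" where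
  "algebra_isomorphic R f S g \<longleftrightarrow> (\<exists>h \<in> ring_iso R S. \<forall>c. h (f c) = g c)"


section \<open>The field of fractions\<close>

definition frac_rel :: "('a, 'c) ring_scheme \<Rightarrow> (('a \<times> 'a) \<times> ('a \<times> 'a)) set" where
  "frac_rel R = {((a, b), (c, d)).
     a \<in> carrier R \<and> b \<in> carrier R - {\<zero>\<^bsub>R\<^esub>} \<and> c \<in> carrier R \<and> d \<in> carrier R - {\<zero>\<^bsub>R\<^esub>} \<and>
     a \<otimes>\<^bsub>R\<^esub> d = c \<otimes>\<^bsub>R\<^esub> b}"

definition frac_class :: "('a, 'c) ring_scheme \<Rightarrow> 'a \<Rightarrow> 'a \<Rightarrow> ('a \<times> 'a) set" where
  "frac_class R a b = frac_rel R `` {(a, b)}"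

definition fraction_field :: "('a, 'c) ring_scheme \<Rightarrow> ('a \<times> 'a) set ring" where
  "fraction_field R =
     \<lparr>carrier = (carrier R \<times> (carrier R - {\<zero>\<^bsub>R\<^esub>})) // frac_rel R,
      monoid.mult = (\<lambda>P Q. \<Union>(a, b) \<in> P. \<Union>(c, d) \<in> Q. frac_class R (a \<otimes>\<^bsub>R\<^esub> c) (b \<otimes>\<^bsub>R\<^esub> d)),
      one = frac_class R \<one>\<^bsub>R\<^esub> \<one>\<^bsub>R\<^esub>,
      ring.zero = frac_class R \<zero>\<^bsub>R\<^esub> \<one>\<^bsub>R\<^esub>,
      add = (\<lambda>P Q. \<Union>(a, b) \<in> P. \<Union>(c, d) \<in> Q.
               frac_class R (a \<otimes>\<^bsub>R\<^esub> d \<oplus>\<^bsub>R\<^esub> c \<otimes>\<^bsub>R\<^esub> b) (b \<otimes>\<^bsub>R\<^esub> d))\<rparr>"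

definition to_frac :: "('a, 'c) ring_scheme \<Rightarrow> 'a \<Rightarrow> ('a \<times> 'a) set" where
  "to_frac R a = frac_class R a \<one>\<^bsub>R\<^esub>"


section \<open>Integral closure and normalization\<close>

text \<open>Polynomials are coefficient lists with the leading coefficient first.\<close>

definition integral_over :: "('a, 'c) ring_scheme \<Rightarrow> 'a set \<Rightarrow> 'a \<Rightarrow> bool" where
  "integral_over K S z \<longleftrightarrow>
     (\<exists>p. polynomial\<^bsub>K\<^esub> S p \<and> p \<noteq> [] \<and> hd p = \<one>\<^bsub>K\<^esub> \<and> ring.eval K p z = \<zero>\<^bsub>K\<^esub>)"

definition normalization :: "('a, 'c) ring_scheme \<Rightarrow> ('a \<times> 'a) set ring" where
  "normalization R = (fraction_field R)\<lparr>carrier :=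
     {z \<in> carrier (fraction_field R). integral_over (fraction_field R) (to_frac R ` carrier R) z}\<rparr>"


section \<open>Sanity checks for the field of fractions\<close>

lemma UN_pair_const:
  assumes "(a, b) \<in> P" "(c, d) \<in> Q"
    and "\<And>a b c d. (a, b) \<in> P \<Longrightarrow> (c, d) \<in> Q \<Longrightarrow> h a b c d = C"
  shows "(\<Union>(a, b) \<in> P. \<Union>(c, d) \<in> Q. h a b c d) = C"
proof
  show "(\<Union>(a, b) \<in> P. \<Union>(c, d) \<in> Q. h a b c d) \<subseteq> C"
    using assms(3) by blast
  show "C \<subseteq> (\<Union>(a, b) \<in> P. \<Union>(c, d) \<in> Q. h a b c d)"
    using assms(3)[OF assms(1,2)] assms(1,2) by blast
qed

context domain
begin

lemma frac_rel_equiv: "equiv (carrier R \<times> (carrier R - {\<zero>})) (frac_rel R)"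
proof (rule equivI)
  show "refl_on (carrier R \<times> (carrier R - {\<zero>})) (frac_rel R)"
    by (auto simp: refl_on_def frac_rel_def)
  show "frac_rel R \<subseteq> (carrier R \<times> (carrier R - {\<zero>})) \<times> (carrier R \<times> (carrier R - {\<zero>}))"
    by (auto simp: frac_rel_def)
  show "sym (frac_rel R)"
    by (auto simp: sym_def frac_rel_def)
  show "trans (frac_rel R)"
  proof (rule transI, clarsimp simp: frac_rel_def)
    fix a b c d e f
    assume c: "a \<in> carrier R" "b \<in> carrier R" "c \<in> carrier R" "d \<in> carrier R" "d \<noteq> \<zero>"
       "e \<in> carrier R" "f \<in> carrier R" and 1: "a \<otimes> d = c \<otimes> b" and 2: "c \<otimes> f = e \<otimes> d"
    have "d \<otimes> (a \<otimes> f) = (a \<otimes> d) \<otimes> f" using c by (simp add: m_ac)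
    also have "\<dots> = (c \<otimes> f) \<otimes> b" using c 1 by (simp add: m_ac)
    also have "\<dots> = d \<otimes> (e \<otimes> b)" using c 2 by (simp add: m_ac)
    finally show "a \<otimes> f = e \<otimes> b" using c m_lcancel by simp
  qed
qed

lemma frac_eq_iff:
  assumes "a \<in> carrier R" "b \<in> carrier R - {\<zero>}" "c \<in> carrier R" "d \<in> carrier R - {\<zero>}"
  shows "frac_class R a b = frac_class R c d \<longleftrightarrow> a \<otimes> d = c \<otimes> b"
proof -
  have "frac_class R a b = frac_class R c d \<longleftrightarrow> ((a, b), (c, d)) \<in> frac_rel R"
    unfolding frac_class_def using assms by (intro eq_equiv_class_iff[OF frac_rel_equiv]) auto
  also have "\<dots> \<longleftrightarrow> a \<otimes> d = c \<otimes> b"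
    using assms by (simp add: frac_rel_def)
  finally show ?thesis .
qed

lemma carrier_fraction_field:
  "carrier (fraction_field R) = {frac_class R a b | a b. a \<in> carrier R \<and> b \<in> carrier R - {\<zero>}}"
  by (auto simp: fraction_field_def frac_class_def quotient_def)

lemma frac_mult:
  assumes "a \<in> carrier R" "b \<in> carrier R - {\<zero>}" "c \<in> carrier R" "d \<in> carrier R - {\<zero>}"
  shows "frac_class R a b \<otimes>\<^bsub>fraction_field R\<^esub> frac_class R c d = frac_class R (a \<otimes> c) (b \<otimes> d)"
proof -
  have *: "frac_class R (a' \<otimes> c') (b' \<otimes> d') = frac_class R (a \<otimes> c) (b \<otimes> d)"
    if "(a', b') \<in> frac_class R a b" "(c', d') \<in> frac_class R c d" for a' b' c' d'
  proof -
    have r: "a' \<in> carrier R" "b' \<in> carrier R - {\<zero>}" "c' \<in> carrier R" "d' \<in> carrier R - {\<zero>}"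
      "a \<otimes> b' = a' \<otimes> b" "c \<otimes> d' = c' \<otimes> d"
      using that by (auto simp: frac_class_def frac_rel_def)
    have "(a' \<otimes> c') \<otimes> (b \<otimes> d) = (a' \<otimes> b) \<otimes> (c' \<otimes> d)"
      using r assms by (simp add: m_ac)
    also have "\<dots> = (a \<otimes> b') \<otimes> (c \<otimes> d')" using r by simp
    also have "\<dots> = (a \<otimes> c) \<otimes> (b' \<otimes> d')" using r(1-4) assms by (simp add: m_ac)
    finally show ?thesis
      using r(1-4) assms by (subst frac_eq_iff) (auto simp: integral_iff)
  qed
  have "(a, b) \<in> frac_class R a b" "(c, d) \<in> frac_class R c d"
    using assms by (auto simp: frac_class_def frac_rel_def)
  thus ?thesis
    using * unfolding fraction_field_def monoid.simps ring.simps by (rule UN_pair_const)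
qed

lemma frac_add:
  assumes "a \<in> carrier R" "b \<in> carrier R - {\<zero>}" "c \<in> carrier R" "d \<in> carrier R - {\<zero>}"
  shows "frac_class R a b \<oplus>\<^bsub>fraction_field R\<^esub> frac_class R c d = frac_class R (a \<otimes> d \<oplus> c \<otimes> b) (b \<otimes> d)"
proof -
  have *: "frac_class R (a' \<otimes> d' \<oplus> c' \<otimes> b') (b' \<otimes> d') = frac_class R (a \<otimes> d \<oplus> c \<otimes> b) (b \<otimes> d)"
    if "(a', b') \<in> frac_class R a b" "(c', d') \<in> frac_class R c d" for a' b' c' d'
  proof -
    have r: "a' \<in> carrier R" "b' \<in> carrier R - {\<zero>}" "c' \<in> carrier R" "d' \<in> carrier R - {\<zero>}"
      "a \<otimes> b' = a' \<otimes> b" "c \<otimes> d' = c' \<otimes> d"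
      using that by (auto simp: frac_class_def frac_rel_def)
    have "(a' \<otimes> d' \<oplus> c' \<otimes> b') \<otimes> (b \<otimes> d) = (a' \<otimes> b) \<otimes> (d \<otimes> d') \<oplus> (c' \<otimes> d) \<otimes> (b \<otimes> b')"
      using r(1-4) assms by (simp add: l_distr r_distr m_ac)
    also have "\<dots> = (a \<otimes> b') \<otimes> (d \<otimes> d') \<oplus> (c \<otimes> d') \<otimes> (b \<otimes> b')" using r by simp
    also have "\<dots> = (a \<otimes> d \<oplus> c \<otimes> b) \<otimes> (b' \<otimes> d')"
      using r(1-4) assms by (simp add: l_distr r_distr m_ac)
    finally show ?thesis
      using r(1-4) assms by (subst frac_eq_iff) (auto simp: integral_iff)
  qed
  have "(a, b) \<in> frac_class R a b" "(c, d) \<in> frac_class R c d"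
    using assms by (auto simp: frac_class_def frac_rel_def)
  thus ?thesis
    using * unfolding fraction_field_def monoid.simps ring.simps by (rule UN_pair_const)
qed

lemma frac_zero: "\<zero>\<^bsub>fraction_field R\<^esub> = frac_class R \<zero> \<one>"
  and frac_one: "\<one>\<^bsub>fraction_field R\<^esub> = frac_class R \<one> \<one>"
  by (simp_all add: fraction_field_def)

lemma frac_carrier:
  assumes "a \<in> carrier R" "b \<in> carrier R - {\<zero>}"
  shows "frac_class R a b \<in> carrier (fraction_field R)"
  using assms by (auto simp: carrier_fraction_field)

lemma frac_cases:
  assumes "x \<in> carrier (fraction_field R)"
  obtains a b where "x = frac_class R a b" "a \<in> carrier R" "b \<in> carrier R" "b \<noteq> \<zero>"
  using assms by (auto simp: carrier_fraction_field)

lemma fraction_field_is_field: "field (fraction_field R)"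
proof -
  let ?F = "fraction_field R"
  note s = frac_mult frac_add frac_zero frac_one frac_carrier integral_iff frac_eq_iff
  have "cring ?F"
  proof (rule cringI)
    show "abelian_group ?F"
    proof (rule abelian_groupI)
      fix x assume "x \<in> carrier ?F"
      then obtain a b where x: "x = frac_class R a b" "a \<in> carrier R" "b \<in> carrier R" "b \<noteq> \<zero>"
        by (rule frac_cases)
      show "\<exists>y\<in>carrier ?F. y \<oplus>\<^bsub>?F\<^esub> x = \<zero>\<^bsub>?F\<^esub>"
        by (rule bexI[of _ "frac_class R (\<ominus> a) b"]) (use x in \<open>simp_all add: s l_minus l_neg\<close>)
      show "\<zero>\<^bsub>?F\<^esub> \<oplus>\<^bsub>?F\<^esub> x = x" using x by (simp add: s)
      fix y assume "y \<in> carrier ?F"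
      then obtain c d where y: "y = frac_class R c d" "c \<in> carrier R" "d \<in> carrier R" "d \<noteq> \<zero>"
        by (rule frac_cases)
      show "x \<oplus>\<^bsub>?F\<^esub> y \<in> carrier ?F" using x y by (simp add: s)
      show "x \<oplus>\<^bsub>?F\<^esub> y = y \<oplus>\<^bsub>?F\<^esub> x" using x y by (simp add: s m_ac a_ac)
      fix z assume "z \<in> carrier ?F"
      then obtain e f where z: "z = frac_class R e f" "e \<in> carrier R" "f \<in> carrier R" "f \<noteq> \<zero>"
        by (rule frac_cases)
      show "x \<oplus>\<^bsub>?F\<^esub> y \<oplus>\<^bsub>?F\<^esub> z = x \<oplus>\<^bsub>?F\<^esub> (y \<oplus>\<^bsub>?F\<^esub> z)"
        using x y z by (simp add: s l_distr r_distr m_ac a_ac)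
    qed (simp add: s)
    show "Group.comm_monoid ?F"
    proof (rule comm_monoidI)
      fix x assume "x \<in> carrier ?F"
      then obtain a b where x: "x = frac_class R a b" "a \<in> carrier R" "b \<in> carrier R" "b \<noteq> \<zero>"
        by (rule frac_cases)
      show "\<one>\<^bsub>?F\<^esub> \<otimes>\<^bsub>?F\<^esub> x = x" using x by (simp add: s)
      fix y assume "y \<in> carrier ?F"
      then obtain c d where y: "y = frac_class R c d" "c \<in> carrier R" "d \<in> carrier R" "d \<noteq> \<zero>"
        by (rule frac_cases)
      show "x \<otimes>\<^bsub>?F\<^esub> y \<in> carrier ?F" using x y by (simp add: s)
      show "x \<otimes>\<^bsub>?F\<^esub> y = y \<otimes>\<^bsub>?F\<^esub> x" using x y by (simp add: s m_ac)
      fix z assume "z \<in> carrier ?F"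
      then obtain e f where z: "z = frac_class R e f" "e \<in> carrier R" "f \<in> carrier R" "f \<noteq> \<zero>"
        by (rule frac_cases)
      show "x \<otimes>\<^bsub>?F\<^esub> y \<otimes>\<^bsub>?F\<^esub> z = x \<otimes>\<^bsub>?F\<^esub> (y \<otimes>\<^bsub>?F\<^esub> z)"
        using x y z by (simp add: s m_ac)
    qed (simp add: s)
    fix x y z assume "x \<in> carrier ?F" "y \<in> carrier ?F" "z \<in> carrier ?F"
    then obtain a b c d e f where x: "x = frac_class R a b" "a \<in> carrier R" "b \<in> carrier R" "b \<noteq> \<zero>"
      and y: "y = frac_class R c d" "c \<in> carrier R" "d \<in> carrier R" "d \<noteq> \<zero>"
      and z: "z = frac_class R e f" "e \<in> carrier R" "f \<in> carrier R" "f \<noteq> \<zero>"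
      by (metis frac_cases)
    show "(x \<oplus>\<^bsub>?F\<^esub> y) \<otimes>\<^bsub>?F\<^esub> z = x \<otimes>\<^bsub>?F\<^esub> z \<oplus>\<^bsub>?F\<^esub> y \<otimes>\<^bsub>?F\<^esub> z"
      using x y z by (simp add: s l_distr r_distr m_ac)
  qed
  thus ?thesis
  proof (rule cring.cring_fieldI2)
    show "\<zero>\<^bsub>?F\<^esub> \<noteq> \<one>\<^bsub>?F\<^esub>" by (simp add: s)
    fix x assume "x \<in> carrier ?F" and x0: "x \<noteq> \<zero>\<^bsub>?F\<^esub>"
    then obtain a b where x: "x = frac_class R a b" "a \<in> carrier R" "b \<in> carrier R" "b \<noteq> \<zero>"
      by (metis frac_cases)
    with x0 have "a \<noteq> \<zero>" by (auto simp: s)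
    with x show "\<exists>y\<in>carrier ?F. x \<otimes>\<^bsub>?F\<^esub> y = \<one>\<^bsub>?F\<^esub>"
      by (intro bexI[of _ "frac_class R b a"]) (simp_all add: s m_ac)
  qed
qed

lemma to_frac_hom: "to_frac R \<in> ring_hom R (fraction_field R)"
  by (rule ring_hom_memI) (simp_all add: to_frac_def frac_mult frac_add frac_one frac_carrier)

lemma to_frac_inj: "inj_on (to_frac R) (carrier R)"
  by (rule inj_onI) (simp add: to_frac_def frac_eq_iff)

end


section \<open>The two affine algebras\<close>

datatype var4 = vx | vy | vt | vs

datatype var5 = vX | vY | vT | vS | vU

definition relations_A :: "(var4, 'k::field) mpoly set" where
  "relations_A = {Var vx ^ 2 * Var vt + Var vy ^ 2 * Var vs + Var vx * Var vy}"

definition relations_B :: "(var5, 'k::field) mpoly set" where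
  "relations_B =
     {Var vY * Var vU - Var vX * Var vT,
      Var vX * Var vU + Var vY * Var vS + Var vX,
      Var vU ^ 2 + Var vU + Var vT * Var vS}"

end

theory Submission
  imports Defs "HOL-Computational_Algebra.Polynomial_Factorial"
begin

text \<open>Put \<open>w = x/y\<close>.  The equation of \<open>A\<close> reads \<open>s = - w (w t + 1)\<close>, so \<open>A\<close> lies in the polynomial ring
\<open>P = k[w, y, t]\<close>, with \<open>x = w y\<close>.  The element \<open>u = w t = x t / y\<close> satisfies \<open>u^2 + u + t s = 0\<close>, hence is
integral over \<open>A\<close>.  The relations of \<open>B\<close> are the \<open>2 \<times> 2\<close> minors of the matrix with rows \<open>(X, U, -S)\<close> and
\<open>(Y, T, U + 1)\<close>, whose rows are proportional with ratio \<open>w\<close>; so \<open>B\<close> maps to \<open>P\<close> as well (the map \<open>chart\<close>),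
with \<open>U\<close> going to \<open>u\<close>.

Geometrically, \<open>Spec B\<close> is the union of two affine spaces.  The first is \<open>Spec P\<close>, and it becomes
equal to \<open>Spec B\<close> where \<open>U + 1\<close> is invertible, because \<open>w = - S / (U + 1)\<close> there.  The second is its
image under the involution \<open>swap\<close> of \<open>B\<close> that exchanges \<open>X\<close> with \<open>Y\<close> and \<open>T\<close> with \<open>S\<close> and sends \<open>U\<close> to
\<open>- 1 - U\<close>; it takes care of the locus where \<open>U\<close> is invertible.  Since \<open>(U + 1) + (- U) = 1\<close>, whatever
holds after multiplication by a power of \<open>U + 1\<close> and by a power of \<open>- U\<close> holds outright
(\<open>comaximal_powers\<close>).  This principle is used twice.

\<^item> An element of \<open>k[X, Y, T, S, U]\<close> that vanishes in \<open>P\<close> is killed modulo the relations by a power of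
  \<open>U + 1\<close> and, by symmetry, by a power of \<open>- U\<close>.  Hence \<open>B\<close> embeds into \<open>P\<close> (\<open>chart_kernel\<close>).  Inverting
  \<open>y\<close> instead of \<open>U + 1\<close> gives that \<open>A\<close> embeds into \<open>P\<close> (\<open>chart_incl_AB_kernel\<close>), because \<open>y\<close> is not a zero
  divisor in \<open>A\<close>.

\<^item> A fraction \<open>a / q\<close> of elements of \<open>A\<close> that is integral over \<open>A\<close> lies in \<open>P\<close>, since \<open>P\<close> is factorial and
  so integrally closed.  Multiplied by a power of \<open>U + 1\<close> it lies in \<open>B\<close>, by symmetry also when multiplied
  by a power of \<open>- U\<close>, so it lies in \<open>B\<close> (\<open>integral_fraction_in_B\<close>).

Conversely \<open>B = A + A u\<close> (\<open>chart_module_basis\<close>), so every element of \<open>B\<close> is a root of a monic quadratic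
polynomial over \<open>A\<close> and becomes an element of \<open>A\<close> after multiplication by \<open>y\<close>.  Thus \<open>B\<close> consists exactly
of the elements of the fraction field that are integral over \<open>A\<close>.\<close>

section \<open>Ring homomorphisms and evaluation of polynomials\<close>

locale type_hom =
  fixes f :: "'a::comm_ring_1 \<Rightarrow> 'b::comm_ring_1"
  assumes add: "f (a + b) = f a + f b"
    and mult: "f (a * b) = f a * f b"
    and one: "f 1 = 1"
begin

lemma zero: "f 0 = 0"
  using add[of 0 0] by simp

lemma uminus: "f (- a) = - f a"
  using add[of a "- a"] zero by (simp add: eq_neg_iff_add_eq_0 add.commute)

lemma diff: "f (a - b) = f a - f b"
  using add[of a "- b"] uminus by simp

lemma power: "f (a ^ n) = f a ^ n"
  by (induction n) (simp_all add: one mult)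

lemmas hom_simps = zero one add mult uminus diff power

end

lemma type_hom_comp: "type_hom f \<Longrightarrow> type_hom g \<Longrightarrow> type_hom (\<lambda>x. g (f x))"
  by (simp add: type_hom_def)

definition eval_poly :: "('a::comm_ring_1 \<Rightarrow> 'b::comm_ring_1) \<Rightarrow> 'b \<Rightarrow> 'a poly \<Rightarrow> 'b" where
  "eval_poly f x p = poly (map_poly f p) x"

lemma type_hom_eval_poly:
  assumes "type_hom f"
  shows "type_hom (eval_poly f x)"
proof -
  interpret type_hom f by fact
  have pc: "eval_poly f x (pCons a p) = f a + x * eval_poly f x p" for a p
    by (simp add: eval_poly_def map_poly_pCons zero)
  have z: "eval_poly f x 0 = 0" by (simp add: eval_poly_def)
  have a: "eval_poly f x (p + q) = eval_poly f x p + eval_poly f x q" for p q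
    by (induction p q rule: poly_induct2) (simp_all add: pc z add algebra_simps)
  have s: "eval_poly f x (Polynomial.smult c p) = f c * eval_poly f x p" for c p
    by (induction p) (simp_all add: pc z mult algebra_simps)
  have m: "eval_poly f x (p * q) = eval_poly f x p * eval_poly f x q" for p q
    by (induction p) (simp_all add: pc z a s zero algebra_simps)
  show ?thesis
    by (standard) (simp_all add: a m, simp add: eval_poly_def one)
qed

lemma eval_poly_const [simp]: "type_hom f \<Longrightarrow> eval_poly f x [:c:] = f c"
  by (simp add: eval_poly_def map_poly_pCons type_hom.zero)

lemma eval_poly_var [simp]: "type_hom f \<Longrightarrow> eval_poly f x [:0, 1:] = x"
  by (simp add: eval_poly_def map_poly_pCons type_hom.zero type_hom.one)

lemma type_hom_const_poly: "type_hom (\<lambda>c. [:c:])"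
  by standard (simp_all add: one_pCons)

lemma Const_hom: "type_hom (Const :: 'k::field \<Rightarrow> ('v, 'k) mpoly)"
  by standard (simp_all add: Const_def single_add mult_single)

lemma update_eq_add_single:
  assumes "k \<notin> Poly_Mapping.keys p"
  shows "Poly_Mapping.update k a p = p + Poly_Mapping.single k a"
  by (rule poly_mapping_eqI)
     (use assms in \<open>auto simp: lookup_update lookup_add lookup_single when_def in_keys_iff\<close>)

text \<open>Polynomials are generated as a ring by constants and variables, so that ring-theoretic facts about
all of them need to be checked on these generators only.\<close>

lemma mpoly_induct [case_names Const Var add mult]:
  fixes p :: "('v, 'k::field) mpoly"
  assumes C: "\<And>c. P (Const c)" and V: "\<And>v. P (Var v)"
    and A: "\<And>p q. P p \<Longrightarrow> P q \<Longrightarrow> P (p + q)" and M: "\<And>p q. P p \<Longrightarrow> P q \<Longrightarrow> P (p * q)"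
  shows "P p"
proof -
  have one: "P 1" using C[of 1] by (simp add: Const_def)
  have Vn: "P (Poly_Mapping.single (Poly_Mapping.single v n) 1)" for v n
  proof (induction n)
    case 0
    show ?case using one by simp
  next
    case (Suc n)
    have "Poly_Mapping.single (Poly_Mapping.single v (Suc n)) 1
        = Poly_Mapping.single (Poly_Mapping.single v n) 1 * Var v"
      by (simp add: Var_def mult_single flip: single_add)
    with Suc V M show ?case by metis
  qed
  have mon: "P (Poly_Mapping.single m 1)" for m
  proof (induction m rule: update_induct)
    case const
    show ?case using one by simp
  next
    case (update m v n)
    have "Poly_Mapping.single (Poly_Mapping.update v n m) 1
        = (Poly_Mapping.single m 1 :: ('v, 'k) mpoly) * Poly_Mapping.single (Poly_Mapping.single v n) 1"
      using update by (simp add: update_eq_add_single mult_single)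
    with update M Vn show ?case by simp
  qed
  show ?thesis
  proof (induction p rule: update_induct)
    case const
    show ?case using C[of 0] by (simp add: Const_def)
  next
    case (update p m c)
    have "Poly_Mapping.update m c p = p + Const c * Poly_Mapping.single m 1"
      using update by (simp add: update_eq_add_single Const_def mult_single)
    with update show ?case using A M C mon by simp
  qed
qed

definition eval_mpoly ::
  "('k::field \<Rightarrow> 'b::comm_ring_1) \<Rightarrow> ('v::finite \<Rightarrow> 'b) \<Rightarrow> ('v, 'k) mpoly \<Rightarrow> 'b" where
  "eval_mpoly \<kappa> f p =
     (\<Sum>m\<in>Poly_Mapping.keys p. \<kappa> (Poly_Mapping.lookup p m) * (\<Prod>v\<in>UNIV. f v ^ Poly_Mapping.lookup m v))"

lemma eval_mpoly_superset:
  assumes "type_hom \<kappa>" "finite M" "Poly_Mapping.keys p \<subseteq> M"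
  shows "eval_mpoly \<kappa> f p =
     (\<Sum>m\<in>M. \<kappa> (Poly_Mapping.lookup p m) * (\<Prod>v\<in>UNIV. f v ^ Poly_Mapping.lookup m v))"
  unfolding eval_mpoly_def
  by (rule sum.mono_neutral_left) (use assms in \<open>auto simp: in_keys_iff type_hom.zero\<close>)

lemma type_hom_eval_mpoly:
  fixes \<kappa> :: "'k::field \<Rightarrow> 'b::comm_ring_1" and f :: "'v::finite \<Rightarrow> 'b"
  assumes k: "type_hom \<kappa>"
  shows "type_hom (eval_mpoly \<kappa> f)"
proof -
  interpret type_hom \<kappa> by fact
  let ?e = "eval_mpoly \<kappa> f"
  have sg: "?e (Poly_Mapping.single m c) = \<kappa> c * (\<Prod>v\<in>UNIV. f v ^ Poly_Mapping.lookup m v)" for m c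
    by (subst eval_mpoly_superset[OF k, of "{m}"]) simp_all
  have ad: "?e (p + q) = ?e p + ?e q" for p q
  proof -
    let ?M = "Poly_Mapping.keys p \<union> Poly_Mapping.keys q"
    have "Poly_Mapping.keys (p + q) \<subseteq> ?M" by (rule keys_add)
    then show ?thesis
      by (simp add: eval_mpoly_superset[OF k, of ?M] lookup_add add distrib_right sum.distrib)
  qed
  have ms: "?e (Poly_Mapping.single m c * Poly_Mapping.single m' c')
      = ?e (Poly_Mapping.single m c) * ?e (Poly_Mapping.single m' c')" for m c m' c'
    by (simp add: mult_single sg mult lookup_add power_add prod.distrib mult_ac)
  have z: "?e 0 = 0" by (simp add: eval_mpoly_def)
  have m1: "?e (p * Poly_Mapping.single m c) = ?e p * ?e (Poly_Mapping.single m c)" for p m c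
    by (induction p rule: update_induct)
       (simp_all add: z update_eq_add_single ad distrib_right ms)
  have m2: "?e (p * q) = ?e p * ?e q" for p q
    by (induction q rule: update_induct)
       (simp_all add: z update_eq_add_single ad distrib_left m1)
  have "?e 1 = 1"
    using sg[of 0 1] by (simp add: one)
  then show ?thesis by (intro type_hom.intro ad m2)
qed

lemma eval_mpoly_Const [simp]:
  assumes k: "type_hom \<kappa>"
  shows "eval_mpoly \<kappa> f (Const c) = \<kappa> c"
  unfolding Const_def by (subst eval_mpoly_superset[OF k, of "{0}"]) simp_all

lemma eval_mpoly_Var [simp]:
  assumes k: "type_hom \<kappa>"
  shows "eval_mpoly \<kappa> f (Var v) = f v"
proof -
  have "(\<Prod>u\<in>UNIV. f u ^ (1 when v = u)) = (\<Prod>u\<in>{v}. f u ^ (1 when v = u))"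
    by (rule prod.mono_neutral_right) (auto simp: when_def)
  then show ?thesis
    unfolding Var_def
    by (subst eval_mpoly_superset[OF k, of "{Poly_Mapping.single v 1}"])
       (simp_all add: type_hom.one[OF k] lookup_single)
qed

lemma type_hom_mpoly_eqI:
  fixes p :: "('v, 'k::field) mpoly"
  assumes "type_hom f" "type_hom g" "\<And>c. f (Const c) = g (Const c)" "\<And>v. f (Var v) = g (Var v)"
  shows "f p = g p"
  by (induction p rule: mpoly_induct) (simp_all add: assms type_hom.add type_hom.mult)

instance var4 :: finite
proof
  have "(UNIV :: var4 set) = {vx, vy, vt, vs}" using var4.exhaust by auto
  then show "finite (UNIV :: var4 set)" by (metis finite.emptyI finite_insert)
qed

instance var5 :: finite
proof
  have "(UNIV :: var5 set) = {vX, vY, vT, vS, vU}" using var5.exhaust by auto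
  then show "finite (UNIV :: var5 set)" by (metis finite.emptyI finite_insert)
qed

text \<open>Multiplication by a monomial shifts the exponents and keeps the coefficients.\<close>

lemma monomial_mult_eq_0:
  assumes "Poly_Mapping.single m 1 * p = (0 :: ('v, 'k::field) mpoly)"
  shows "p = 0"
proof -
  have "Poly_Mapping.lookup (Poly_Mapping.single m 1 * p) (m + n) = Poly_Mapping.lookup p n" for n
    by (induction p rule: update_induct)
       (simp_all add: update_eq_add_single distrib_left mult_single lookup_add lookup_single when_def)
  with assms show ?thesis by (metis lookup_zero poly_mapping_eqI)
qed

section \<open>The polynomial ring in \<open>w\<close>, \<open>y\<close>, \<open>t\<close>\<close>

text \<open>Unique factorisation in iterated polynomial rings requires a coefficient ring with chosen
representatives of associate classes and a greatest common divisor.  A type of class \<open>field\<close> does not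
come with these operations; its copy \<open>fld\<close> is equipped with the trivial ones, for which
every nonzero element is associated to \<open>1\<close>.\<close>

typedef 'a fld = "UNIV :: 'a set" ..

setup_lifting type_definition_fld

instantiation fld :: (field) field
begin
lift_definition zero_fld :: "'a fld" is 0 .
lift_definition one_fld :: "'a fld" is 1 .
lift_definition plus_fld :: "'a fld \<Rightarrow> 'a fld \<Rightarrow> 'a fld" is "(+)" .
lift_definition minus_fld :: "'a fld \<Rightarrow> 'a fld \<Rightarrow> 'a fld" is "(-)" .
lift_definition uminus_fld :: "'a fld \<Rightarrow> 'a fld" is "uminus" .
lift_definition times_fld :: "'a fld \<Rightarrow> 'a fld \<Rightarrow> 'a fld" is "(*)" .
lift_definition divide_fld :: "'a fld \<Rightarrow> 'a fld \<Rightarrow> 'a fld" is "(/)" .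
lift_definition inverse_fld :: "'a fld \<Rightarrow> 'a fld" is "inverse" .
instance
  by standard (transfer; simp add: algebra_simps divide_inverse)+
end

instantiation fld :: (field)
  "{unique_euclidean_ring, normalization_euclidean_semiring, normalization_semidom_multiplicative}"
begin
definition [simp]: "normalize (x :: 'a fld) = (if x = 0 then 0 else 1)"
definition [simp]: "unit_factor (x :: 'a fld) = x"
definition [simp]: "(x :: 'a fld) mod y = (if y = 0 then x else 0)"
definition [simp]: "euclidean_size (x :: 'a fld) = (if x = 0 then 0 else 1 :: nat)"
definition [simp]: "division_segment (x :: 'a fld) = 1"
instance
  by standard (simp_all add: dvd_field_iff field_split_simps split: if_splits)
end

instantiation fld :: (field) euclidean_ring_gcd
begin
definition "gcd = (Euclidean_Algorithm.gcd :: 'a fld \<Rightarrow> 'a fld \<Rightarrow> 'a fld)"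
definition "lcm = (Euclidean_Algorithm.lcm :: 'a fld \<Rightarrow> 'a fld \<Rightarrow> 'a fld)"
definition "Gcd = (Euclidean_Algorithm.Gcd :: 'a fld set \<Rightarrow> 'a fld)"
definition "Lcm = (Euclidean_Algorithm.Lcm :: 'a fld set \<Rightarrow> 'a fld)"
instance by standard (simp_all add: gcd_fld_def lcm_fld_def Gcd_fld_def Lcm_fld_def)
end

instance fld :: (field) field_gcd ..

lemma Abs_fld_hom: "type_hom (Abs_fld :: 'k::field \<Rightarrow> 'k fld)"
  by standard (simp_all add: plus_fld.abs_eq times_fld.abs_eq one_fld_def)

lemma Rep_fld_hom: "type_hom (Rep_fld :: 'k fld \<Rightarrow> 'k::field)"
  by standard (simp_all add: plus_fld.rep_eq times_fld.rep_eq one_fld.rep_eq)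

text \<open>The ring \<open>P\<close>.  The outermost variable is \<open>w\<close>, the innermost one is \<open>t\<close>.\<close>

type_synonym 'k poly3 = "'k fld poly poly poly"

definition const3 :: "'k::field \<Rightarrow> 'k poly3" where
  "const3 c = [:[:[:Abs_fld c:]:]:]"

definition varw :: "'k::field poly3" where "varw = [:0, 1:]"
definition vary :: "'k::field poly3" where "vary = [:[:0, 1:]:]"
definition vart :: "'k::field poly3" where "vart = [:[:[:0, 1:]:]:]"

lemma type_hom_const3: "type_hom const3"
  unfolding const3_def
  by (rule type_hom_comp[OF type_hom_comp[OF type_hom_comp[OF Abs_fld_hom type_hom_const_poly]
        type_hom_const_poly] type_hom_const_poly])

lemma poly_closure:
  fixes p :: "'a::comm_ring_1 poly"
  assumes "\<And>c. Q [:c:]" "Q [:0, 1:]" "\<And>p q. Q p \<Longrightarrow> Q q \<Longrightarrow> Q (p + q)" "\<And>p q. Q p \<Longrightarrow> Q q \<Longrightarrow> Q (p * q)"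
  shows "Q p"
proof (induction p)
  case 0
  show ?case using assms(1)[of 0] by simp
next
  case (pCons a p)
  have "pCons a p = [:a:] + [:0, 1:] * p" by simp
  then show ?case using assms pCons by metis
qed

lemma poly3_induct [case_names const w y t add mult]:
  fixes p :: "'k::field poly3"
  assumes c: "\<And>c. Q (const3 c)" and w: "Q varw" and y: "Q vary" and t: "Q vart"
    and a: "\<And>p q. Q p \<Longrightarrow> Q q \<Longrightarrow> Q (p + q)" and m: "\<And>p q. Q p \<Longrightarrow> Q q \<Longrightarrow> Q (p * q)"
  shows "Q p"
proof -
  have inner: "Q [:[:p:]:]" for p
  proof (induction p rule: poly_closure)
    case (1 c)
    show ?case using c[of "Rep_fld c"] by (simp add: const3_def Rep_fld_inverse)
  next
    case 2
    show ?case using t by (simp add: vart_def)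
  next
    case (3 p q)
    then show ?case using a[of "[:[:p:]:]" "[:[:q:]:]"] by simp
  next
    case (4 p q)
    then show ?case using m[of "[:[:p:]:]" "[:[:q:]:]"] by simp
  qed
  have middle: "Q [:p:]" for p
  proof (induction p rule: poly_closure)
    case (1 c)
    show ?case by (rule inner)
  next
    case 2
    show ?case using y by (simp add: vary_def)
  next
    case (3 p q)
    then show ?case using a[of "[:p:]" "[:q:]"] by simp
  next
    case (4 p q)
    then show ?case using m[of "[:p:]" "[:q:]"] by (simp add: mult.commute)
  qed
  show ?thesis
    by (induction p rule: poly_closure) (use middle a m w in \<open>simp_all add: varw_def\<close>)
qed

definition eval3 :: "('k::field \<Rightarrow> 'b::comm_ring_1) \<Rightarrow> 'b \<Rightarrow> 'b \<Rightarrow> 'b \<Rightarrow> 'k poly3 \<Rightarrow> 'b" where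
  "eval3 \<kappa> w y t = eval_poly (eval_poly (eval_poly (\<lambda>c. \<kappa> (Rep_fld c)) t) y) w"

lemma eval3:
  assumes "type_hom \<kappa>"
  shows "type_hom (eval3 \<kappa> w y t)" "eval3 \<kappa> w y t (const3 c) = \<kappa> c"
    "eval3 \<kappa> w y t varw = w" "eval3 \<kappa> w y t vary = y" "eval3 \<kappa> w y t vart = t"
proof -
  have 0: "type_hom (\<lambda>c. \<kappa> (Rep_fld c))"
    using Rep_fld_hom assms by (rule type_hom_comp)
  note 1 = type_hom_eval_poly[OF 0, of t]
  note 2 = type_hom_eval_poly[OF 1, of y]
  note 3 = type_hom_eval_poly[OF 2, of w]
  show "type_hom (eval3 \<kappa> w y t)" "eval3 \<kappa> w y t (const3 c) = \<kappa> c"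
    "eval3 \<kappa> w y t varw = w" "eval3 \<kappa> w y t vary = y" "eval3 \<kappa> w y t vart = t"
    using 0 1 2 3 by (simp_all add: eval3_def const3_def varw_def vary_def vart_def Abs_fld_inverse)
qed

text \<open>For the coefficient list \<open>l\<close> (leading coefficient first) of a polynomial \<open>f\<close> and \<open>n = length l\<close>,
\<open>q * horner p q l\<close> is the cleared form \<open>q^n * f (p / q)\<close>.  Thus \<open>p^n + q * horner p q l = 0\<close> says that
\<open>p / q\<close> is a root of the monic polynomial with coefficients \<open>1 # l\<close>, without mention of fractions.\<close>

fun horner :: "'a::comm_ring_1 \<Rightarrow> 'a \<Rightarrow> 'a list \<Rightarrow> 'a" where
  "horner p q [] = 0"
| "horner p q (c # l) = c * p ^ length l + q * horner p q l"

lemma horner_homogeneous: "g * horner (g * p) (g * q) l = g ^ length l * horner p q l"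
proof (induction l)
  case (Cons c l)
  have "g * horner (g * p) (g * q) (c # l)
      = g ^ Suc (length l) * (c * p ^ length l) + g * q * (g * horner (g * p) (g * q) l)"
    by (simp add: algebra_simps)
  then show ?case
    unfolding Cons.IH by (simp add: algebra_simps)
qed simp

lemma (in type_hom) hom_horner: "f (horner p q l) = horner (f p) (f q) (map f l)"
  by (induction l) (simp_all add: hom_simps)

text \<open>The rational root argument: after division by the greatest common divisor, homogeneity keeps the
equation intact, and the denominator divides a power of the coprime numerator.\<close>

lemma poly3_integrally_closed:
  fixes p q :: "'k::field poly3"
  assumes "p ^ length l + q * horner p q l = 0" "q \<noteq> 0"
  shows "q dvd p"
proof -
  define g where "g = gcd p q"
  have g0: "g \<noteq> 0" using assms(2) by (simp add: g_def)
  obtain p' q' where g: "p = g * p'" "q = g * q'" "coprime p' q'"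
    using gcd_coprime_exists[of p q] g0 unfolding g_def by (auto simp: mult.commute)
  have "g ^ length l * (p' ^ length l + q' * horner p' q' l)
      = (g * p') ^ length l + q' * (g * horner (g * p') (g * q') l)"
    unfolding horner_homogeneous by (simp add: algebra_simps)
  also have "\<dots> = 0"
    using assms(1) unfolding g(1,2) by (simp add: algebra_simps)
  finally have "p' ^ length l = q' * (- horner p' q' l)"
    using g0 by (simp add: eq_neg_iff_add_eq_0)
  then have "q' dvd p' ^ length l" by (metis dvd_triv_left)
  moreover have "coprime (p' ^ length l) q'" using g(3) by simp
  ultimately have "is_unit q'"
    by (intro coprime_common_divisor[of "p' ^ length l" q' q']) simp_all
  then show ?thesis using g by (simp add: unit_imp_dvd)
qed

section \<open>Ideals and localization\<close>

lemma ideal_of_typeI: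
  fixes I :: "'a::comm_ring_1 set"
  assumes "0 \<in> I" "\<And>a b. a \<in> I \<Longrightarrow> b \<in> I \<Longrightarrow> a + b \<in> I" "\<And>r a. a \<in> I \<Longrightarrow> r * a \<in> I"
  shows "ideal I ring_of_type_algebra"
proof (rule idealI)
  interpret ring "ring_of_type_algebra :: 'a ring" by (rule ring_from_type_algebra)
  show "ring (ring_of_type_algebra :: 'a ring)" by (rule ring_from_type_algebra)
  have ainv: "\<ominus>\<^bsub>ring_of_type_algebra\<^esub> a = - a" for a :: 'a
    by (rule minus_equality) (simp_all add: ring_of_type_algebra_def)
  show "subgroup I (add_monoid (ring_of_type_algebra :: 'a ring))"
  proof (rule add.subgroupI)
    fix a assume "a \<in> I"
    then show "\<ominus>\<^bsub>ring_of_type_algebra\<^esub> a \<in> I"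
      using assms(3)[of a "- 1"] ainv by simp
  qed (use assms in \<open>auto simp: ring_of_type_algebra_def\<close>)
qed (use assms in \<open>auto simp: ring_of_type_algebra_def mult.commute\<close>)

lemma ideal_of_typeD:
  fixes I :: "'a::comm_ring_1 set"
  assumes "ideal I ring_of_type_algebra"
  shows "0 \<in> I" "a \<in> I \<Longrightarrow> b \<in> I \<Longrightarrow> a + b \<in> I" "a \<in> I \<Longrightarrow> r * a \<in> I"
    "a \<in> I \<Longrightarrow> b \<in> I \<Longrightarrow> a - b \<in> I"
proof -
  interpret ideal I "ring_of_type_algebra :: 'a ring" by fact
  show z: "0 \<in> I" using additive_subgroup.zero_closed[OF is_additive_subgroup] by (simp add: ring_of_type_algebra_def)
  show a: "a \<in> I \<Longrightarrow> b \<in> I \<Longrightarrow> a + b \<in> I" for a b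
    using additive_subgroup.a_closed[OF is_additive_subgroup] by (simp add: ring_of_type_algebra_def)
  show m: "a \<in> I \<Longrightarrow> r * a \<in> I" for r a
    using I_l_closed by (simp add: ring_of_type_algebra_def)
  show "a \<in> I \<Longrightarrow> b \<in> I \<Longrightarrow> a - b \<in> I"
    using a[of a "- b"] m[of b "- 1"] by simp
qed

abbreviation (input) ideal_gen :: "'a::comm_ring_1 set \<Rightarrow> 'a set" where
  "ideal_gen S \<equiv> Idl\<^bsub>ring_of_type_algebra\<^esub> S"

lemma ideal_gen: "ideal (ideal_gen S) (ring_of_type_algebra :: 'a::comm_ring_1 ring)"
  by (rule ring.genideal_ideal[OF ring_from_type_algebra]) (simp add: ring_of_type_algebra_def)

lemma ideal_gen_self: "s \<in> S \<Longrightarrow> s \<in> ideal_gen S"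
  using ring.genideal_self[OF ring_from_type_algebra, of S] by (auto simp: ring_of_type_algebra_def)

lemma ideal_gen_subset:
  fixes I :: "'a::comm_ring_1 set"
  assumes "S \<subseteq> I" "0 \<in> I" "\<And>a b. a \<in> I \<Longrightarrow> b \<in> I \<Longrightarrow> a + b \<in> I" "\<And>r a. a \<in> I \<Longrightarrow> r * a \<in> I"
  shows "ideal_gen S \<subseteq> I"
  using assms by (intro ring.genideal_minimal[OF ring_from_type_algebra] ideal_of_typeI) auto

lemma (in type_hom) hom_ideal_gen:
  assumes "ideal J ring_of_type_algebra" "\<And>s. s \<in> S \<Longrightarrow> f s \<in> J" "x \<in> ideal_gen S"
  shows "f x \<in> J"
proof -
  have "ideal_gen S \<subseteq> {x. f x \<in> J}"
    by (rule ideal_gen_subset) (use assms ideal_of_typeD[OF assms(1)] in \<open>auto simp: hom_simps\<close>)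
  with assms(3) show ?thesis by auto
qed

text \<open>The gluing principle for a cover by two principal open sets: \<open>M\<close> plays the role of a submodule, and
membership in it is local.\<close>

lemma comaximal_powers:
  fixes M :: "'a::comm_ring_1 set"
  assumes one: "a + b = 1"
    and M: "\<And>x y. x \<in> M \<Longrightarrow> y \<in> M \<Longrightarrow> x + y \<in> M" "\<And>x. x \<in> M \<Longrightarrow> a * x \<in> M" "\<And>x. x \<in> M \<Longrightarrow> b * x \<in> M"
    and z: "a ^ n * z \<in> M" "b ^ m * z \<in> M"
  shows "z \<in> M"
proof -
  have split: "a * z + b * z = z" for z
    using one by (metis distrib_right mult_1)
  have 1: "z \<in> M" if "a * z \<in> M" "b ^ m * z \<in> M" for z
    using that
  proof (induction m arbitrary: z)
    case (Suc m)
    have "b * z \<in> M"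
      by (rule Suc.IH) (use Suc.prems M(3)[of "a * z"] in \<open>simp_all add: ac_simps\<close>)
    with Suc.prems(1) M(1) split show ?case by metis
  qed simp
  show ?thesis
    using z
  proof (induction n arbitrary: z)
    case (Suc n)
    have "a * z \<in> M"
      by (rule Suc.IH) (use Suc.prems M(2)[of "b ^ m * z"] in \<open>simp_all add: ac_simps\<close>)
    with 1 Suc.prems(2) show ?case by blast
  qed simp
qed

text \<open>Rabinowitsch's trick.  Let \<open>R\<close> be the polynomial ring.  If modulo \<open>J\<close> and \<open>h Z - 1\<close> each variable is
recovered from its image under \<open>\<phi>\<close> by a homomorphism \<open>\<Psi>\<close> into \<open>R[Z]\<close>, then \<open>\<phi>\<close> is injective on
\<open>(R / J)[1/h]\<close>, so an element of its kernel is killed modulo \<open>J\<close> by a power of \<open>h\<close>.  The elements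
congruent to \<open>0\<close> modulo \<open>J\<close> and \<open>h Z - 1\<close> form the ideal \<open>Q\<close> of \<open>R[Z]\<close>.\<close>

lemma localization_kernel:
  fixes \<phi> :: "('v::finite, 'k::field) mpoly \<Rightarrow> 'c::comm_ring_1"
    and \<Psi> :: "'c \<Rightarrow> ('v, 'k) mpoly poly" and J :: "('v, 'k) mpoly set"
  assumes J: "ideal J ring_of_type_algebra"
    and \<phi>: "type_hom \<phi>" and \<Psi>: "type_hom \<Psi>"
    and const: "\<And>c. \<Psi> (\<phi> (Const c)) = [:Const c:]"
    and var: "\<And>v. \<exists>c. \<forall>i. Polynomial.coeff ([:Var v:] - \<Psi> (\<phi> (Var v)) - c * [:- 1, h:]) i \<in> J"
    and b: "\<phi> b = 0"
  shows "\<exists>n. h ^ n * b \<in> J"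
proof -
  note J = ideal_of_typeD[OF J]
  interpret \<phi>: type_hom \<phi> by fact
  interpret \<Psi>: type_hom \<Psi> by fact
  define Q where "Q g \<longleftrightarrow> (\<exists>c. \<forall>i. Polynomial.coeff (g - c * [:- 1, h:]) i \<in> J)" for g
  have Q_add: "Q (g + g')" if "Q g" "Q g'" for g g'
  proof -
    from that obtain c c' where c: "\<And>i. Polynomial.coeff (g - c * [:- 1, h:]) i \<in> J"
      "\<And>i. Polynomial.coeff (g' - c' * [:- 1, h:]) i \<in> J"
      unfolding Q_def by blast
    have eq: "g + g' - (c + c') * [:- 1, h:] = (g - c * [:- 1, h:]) + (g' - c' * [:- 1, h:])"
      by (simp only: distrib_right) (simp add: algebra_simps)
    have "Polynomial.coeff (g + g' - (c + c') * [:- 1, h:]) i \<in> J" for i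
      unfolding eq coeff_add by (intro J c)
    then show ?thesis unfolding Q_def by blast
  qed
  have Q_mult: "Q (r * g)" if "Q g" for r g
  proof -
    from that obtain c where c: "\<And>i. Polynomial.coeff (g - c * [:- 1, h:]) i \<in> J"
      unfolding Q_def by blast
    have J_sum: "sum u S \<in> J" if "\<And>j. u j \<in> J" for u and S :: "nat set"
      by (induction S rule: infinite_finite_induct) (auto intro: J that)
    have eq: "r * g - (r * c) * [:- 1, h:] = r * (g - c * [:- 1, h:])"
      by (simp only: right_diff_distrib mult.assoc)
    have "Polynomial.coeff (r * g - (r * c) * [:- 1, h:]) i \<in> J" for i
      unfolding eq coeff_mult by (intro J_sum J c)
    then show ?thesis unfolding Q_def by blast
  qed
  have "Q ([:b:] - \<Psi> (\<phi> b))"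
  proof (induction b rule: mpoly_induct)
    case (Const c)
    show ?case unfolding Q_def const by (rule exI[of _ 0]) (simp add: J)
  next
    case (Var v)
    show ?case unfolding Q_def by (rule var)
  next
    case (add p q)
    have "[:p + q:] = [:p:] + [:q:]" by simp
    then have "[:p + q:] - \<Psi> (\<phi> (p + q)) = ([:p:] - \<Psi> (\<phi> p)) + ([:q:] - \<Psi> (\<phi> q))"
      by (simp only: \<phi>.add \<Psi>.add) (simp only: algebra_simps)
    then show ?case using Q_add[OF add] by simp
  next
    case (mult p q)
    have "[:p * q:] = [:p:] * [:q:]" by simp
    then have "[:p * q:] - \<Psi> (\<phi> (p * q))
        = [:p:] * ([:q:] - \<Psi> (\<phi> q)) + \<Psi> (\<phi> q) * ([:p:] - \<Psi> (\<phi> p))"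
      by (simp only: \<phi>.mult \<Psi>.mult) (simp only: algebra_simps)
    then show ?case using Q_add[OF Q_mult[OF mult(2)] Q_mult[OF mult(1)]] by (simp only:)
  qed
  then have "Q [:b:]" by (simp add: b \<phi>.zero \<Psi>.zero)
  then obtain c where c: "\<And>i. Polynomial.coeff ([:b:] - c * [:- 1, h:]) i \<in> J"
    unfolding Q_def by blast
  have eq: "[:b:] - c * [:- 1, h:] = [:b:] + c - pCons 0 (Polynomial.smult h c)"
    by (simp add: algebra_simps)
  \<comment> \<open>Modulo \<open>J\<close>, the constant \<open>b\<close> is a multiple \<open>c (h Z - 1)\<close>; comparing coefficients determines \<open>c\<close> recursively.\<close>
  have "h ^ i * b + Polynomial.coeff c i \<in> J" for i
  proof (induction i)
    case 0
    show ?case using c[of 0] unfolding eq by simp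
  next
    case (Suc i)
    have "Polynomial.coeff c (Suc i) - h * Polynomial.coeff c i \<in> J"
      using c[of "Suc i"] unfolding eq by (simp add: coeff_pCons)
    from J(2)[OF this J(3)[OF Suc, of h]] show ?case
      by (simp add: algebra_simps)
  qed
  \<comment> \<open>Beyond the degree of \<open>c\<close> the coefficients vanish.\<close>
  from this[of "Suc (Polynomial.degree c)"] have "h ^ Suc (Polynomial.degree c) * b \<in> J"
    by (simp add: coeff_eq_0)
  then show ?thesis by blast
qed

section \<open>The algebra \<open>B\<close> inside the polynomial ring\<close>

definition chart :: "(var5, 'k::field) mpoly \<Rightarrow> 'k poly3" where
  "chart = eval_mpoly const3
     (case_var5 (varw * vary) vary vart (- (varw * (varw * vart + 1))) (varw * vart))"

lemma type_hom_chart: "type_hom chart"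
  unfolding chart_def by (rule type_hom_eval_mpoly[OF type_hom_const3])

interpretation chart: type_hom chart by (rule type_hom_chart)

lemma chart_gens [simp]:
  "chart (Const c) = const3 c" "chart (Var vX) = varw * vary" "chart (Var vY) = vary"
  "chart (Var vT) = vart" "chart (Var vS) = - (varw * (varw * vart + 1))"
  "chart (Var vU) = varw * vart"
  by (simp_all add: chart_def type_hom_const3)

text \<open>On the matrix whose minors are the relations of \<open>B\<close>, this exchanges the two rows and the last two
columns, up to signs of columns; so it preserves the ideal of the relations.\<close>

definition swap :: "(var5, 'k::field) mpoly \<Rightarrow> (var5, 'k) mpoly" where
  "swap = eval_mpoly Const (case_var5 (Var vY) (Var vX) (Var vS) (Var vT) (- 1 - Var vU))"

lemma type_hom_swap: "type_hom swap"
  unfolding swap_def by (rule type_hom_eval_mpoly[OF Const_hom])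

interpretation swap: type_hom swap by (rule type_hom_swap)

lemma swap_gens [simp]:
  "swap (Const c) = Const c" "swap (Var vX) = Var vY" "swap (Var vY) = Var vX"
  "swap (Var vT) = Var vS" "swap (Var vS) = Var vT" "swap (Var vU) = - 1 - Var vU"
  by (simp_all add: swap_def Const_hom)

lemma swap_swap [simp]: "swap (swap b) = b"
proof (rule type_hom_mpoly_eqI[of "\<lambda>b. swap (swap b)" "\<lambda>b. b"])
  show "type_hom (\<lambda>b. swap (swap b))" by (rule type_hom_comp[OF type_hom_swap type_hom_swap])
  show "type_hom (\<lambda>b :: (var5, 'a) mpoly. b)" by standard simp_all
  show "swap (swap (Var v)) = Var v" for v by (cases v) (simp_all add: swap.hom_simps)
qed simp

definition incl_AB :: "(var4, 'k::field) mpoly \<Rightarrow> (var5, 'k) mpoly" where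
  "incl_AB = eval_mpoly Const (case_var4 (Var vX) (Var vY) (Var vT) (Var vS))"

lemma type_hom_incl_AB: "type_hom incl_AB"
  unfolding incl_AB_def by (rule type_hom_eval_mpoly[OF Const_hom])

interpretation incl_AB: type_hom incl_AB by (rule type_hom_incl_AB)

lemma incl_AB_gens [simp]:
  "incl_AB (Const c) = Const c" "incl_AB (Var vx) = Var vX" "incl_AB (Var vy) = Var vY"
  "incl_AB (Var vt) = Var vT" "incl_AB (Var vs) = Var vS"
  by (simp_all add: incl_AB_def Const_hom)

abbreviation ideal_A :: "(var4, 'k::field) mpoly set" where "ideal_A \<equiv> ideal_gen relations_A"
abbreviation ideal_B :: "(var5, 'k::field) mpoly set" where "ideal_B \<equiv> ideal_gen relations_B"

lemmas ideal_BD = ideal_of_typeD[OF ideal_gen[of relations_B]]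

lemma relations_in_ideal_B:
  "Var vY * Var vU - Var vX * Var vT \<in> ideal_B"
  "Var vX * Var vU + Var vY * Var vS + Var vX \<in> ideal_B"
  "Var vU ^ 2 + Var vU + Var vT * Var vS \<in> ideal_B"
  by (rule ideal_gen_self, simp add: relations_B_def)+

lemma swap_ideal_B:
  fixes b :: "(var5, 'k::field) mpoly"
  assumes "b \<in> ideal_B"
  shows "swap b \<in> ideal_B"
proof (rule swap.hom_ideal_gen[OF ideal_gen _ assms])
  fix s :: "(var5, 'k) mpoly" assume "s \<in> relations_B"
  then consider "s = Var vY * Var vU - Var vX * Var vT" | "s = Var vX * Var vU + Var vY * Var vS + Var vX"
    | "s = Var vU ^ 2 + Var vU + Var vT * Var vS" by (auto simp: relations_B_def)
  then show "swap s \<in> ideal_B"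
  proof cases
    case 1
    have eq: "swap s = (- 1) * (Var vX * Var vU + Var vY * Var vS + Var vX)"
      unfolding 1 by (simp add: swap.hom_simps algebra_simps)
    show ?thesis unfolding eq by (intro ideal_BD(3) relations_in_ideal_B)
  next
    case 2
    have eq: "swap s = (- 1) * (Var vY * Var vU - Var vX * Var vT)"
      unfolding 2 by (simp add: swap.hom_simps algebra_simps)
    show ?thesis unfolding eq by (intro ideal_BD(3) relations_in_ideal_B)
  next
    case 3
    have eq: "swap s = s"
      unfolding 3 by (simp add: swap.hom_simps algebra_simps power2_eq_square)
    show ?thesis unfolding eq unfolding 3 by (rule relations_in_ideal_B)
  qed
qed

lemma chart_ideal_B:
  assumes "b \<in> ideal_B"
  shows "chart b = 0"
proof -
  have "ideal {0 :: 'a poly3} ring_of_type_algebra" by (rule ideal_of_typeI) auto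
  moreover have "chart s \<in> {0}" if "s \<in> relations_B" for s :: "(var5, 'a) mpoly"
  proof -
    from that consider "s = Var vY * Var vU - Var vX * Var vT"
      | "s = Var vX * Var vU + Var vY * Var vS + Var vX"
      | "s = Var vU ^ 2 + Var vU + Var vT * Var vS" by (auto simp: relations_B_def)
    then have "chart s = 0"
      by cases (simp_all only: chart.hom_simps chart_gens, simp_all add: algebra_simps power2_eq_square)
    then show ?thesis by simp
  qed
  ultimately have "chart b \<in> {0}"
    using assms by (rule chart.hom_ideal_gen)
  then show ?thesis by simp
qed

lemma vars_nonzero: "varw \<noteq> 0" "vary \<noteq> 0" "vart \<noteq> 0"
  by (simp_all add: varw_def vary_def vart_def)

text \<open>Where \<open>Z\<close> inverts \<open>U + 1\<close>, the ratio \<open>w\<close> of the two rows is \<open>- S Z\<close>, which determines the inverse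
homomorphism \<open>\<Psi>\<close>.\<close>

lemma chart_kernel_localized:
  fixes b :: "(var5, 'k::field) mpoly"
  assumes "chart b = 0"
  shows "\<exists>n. (Var vU + 1) ^ n * b \<in> ideal_B"
proof (rule localization_kernel[OF ideal_gen type_hom_chart _ _ _ assms])
  let ?X = "Var vX :: (var5, 'k) mpoly" and ?Y = "Var vY :: (var5, 'k) mpoly"
    and ?T = "Var vT :: (var5, 'k) mpoly" and ?S = "Var vS :: (var5, 'k) mpoly"
    and ?U = "Var vU :: (var5, 'k) mpoly"
  let ?\<kappa> = "\<lambda>c. [:Const c:] :: (var5, 'k) mpoly poly"
  let ?\<Psi> = "eval3 ?\<kappa> [:0, - ?S:] [:?Y:] [:?T:]"
  have \<kappa>: "type_hom ?\<kappa>" using Const_hom type_hom_const_poly by (rule type_hom_comp)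
  show \<Psi>: "type_hom ?\<Psi>" by (rule eval3(1)[OF \<kappa>])
  interpret \<Psi>: type_hom ?\<Psi> by (rule \<Psi>)
  show "?\<Psi> (chart (Const c)) = [:Const c:]" for c by (simp add: eval3[OF \<kappa>])
  note [simp] = chart.hom_simps \<Psi>.hom_simps eval3(2-5)[OF \<kappa>] ideal_BD(1)
  \<comment> \<open>For each variable, \<open>c\<close> is the quotient upon division by \<open>(U + 1) Z - 1\<close>, and the
    remainder has coefficients that are multiples of the relations.\<close>
  have witness: "\<exists>c. \<forall>i. Polynomial.coeff ([:Var v:] - ?\<Psi> (chart (Var v)) - c * [:- 1, ?U + 1:]) i \<in> ideal_B"
    if "[:Var v:] - ?\<Psi> (chart (Var v)) - c * [:- 1, ?U + 1:] = [:0, d1, d2:]" "d1 \<in> ideal_B" "d2 \<in> ideal_B"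
    for v c d1 d2
    by (rule exI[of _ c]) (use that in \<open>auto simp: coeff_pCons split: nat.splits\<close>)
  fix v show "\<exists>c. \<forall>i. Polynomial.coeff ([:Var v:] - ?\<Psi> (chart (Var v)) - c * [:- 1, ?U + 1:]) i \<in> ideal_B"
  proof (cases v)
    case [simp]: vX
    show ?thesis
      by (rule witness[of v "[:- ?X:]" "?X * ?U + ?Y * ?S + ?X" 0])
         (use relations_in_ideal_B in \<open>simp_all add: algebra_simps\<close>)
  next
    case [simp]: vY
    show ?thesis by (rule witness[of v 0 0 0]) simp_all
  next
    case [simp]: vT
    show ?thesis by (rule witness[of v 0 0 0]) simp_all
  next
    case [simp]: vS
    show ?thesis
    proof (rule witness[of v "[:- ?S, - ?S * ?U:]" 0 "?S * (?U ^ 2 + ?U + ?T * ?S)"])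
      show "?S * (?U ^ 2 + ?U + ?T * ?S) \<in> ideal_B" by (intro ideal_BD(3) relations_in_ideal_B)
    qed (simp_all add: algebra_simps power2_eq_square)
  next
    case [simp]: vU
    show ?thesis
      by (rule witness[of v "[:- ?U:]" "?U ^ 2 + ?U + ?T * ?S" 0])
         (use relations_in_ideal_B in \<open>simp_all add: algebra_simps power2_eq_square\<close>)
  qed
qed

text \<open>The image of \<open>swap (U + 1)\<close> is \<open>- w t\<close>, which is not a zero divisor in the domain \<open>P\<close>; so the power of
\<open>U + 1\<close> that is needed to enter the ideal can be cancelled on the other chart.\<close>

lemma chart_swap_zero:
  assumes "chart b = 0"
  shows "chart (swap b) = 0"
proof -
  from chart_kernel_localized[OF assms] obtain n where "(Var vU + 1) ^ n * b \<in> ideal_B" by blast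
  then have "chart (swap ((Var vU + 1) ^ n * b)) = 0"
    by (intro chart_ideal_B swap_ideal_B)
  then show ?thesis
    by (simp add: chart.hom_simps swap.hom_simps vars_nonzero)
qed

lemma chart_kernel: "chart b = 0 \<longleftrightarrow> b \<in> ideal_B"
proof
  assume b: "chart b = 0"
  from chart_kernel_localized[OF b] obtain n where n: "(Var vU + 1) ^ n * b \<in> ideal_B" by blast
  from chart_kernel_localized[OF chart_swap_zero[OF b]] obtain m
    where "(Var vU + 1) ^ m * swap b \<in> ideal_B" by blast
  then have "swap ((Var vU + 1) ^ m * swap b) \<in> ideal_B" by (rule swap_ideal_B)
  then have m: "(- Var vU) ^ m * b \<in> ideal_B" by (simp add: swap.hom_simps)
  show "b \<in> ideal_B"
    by (rule comaximal_powers[OF _ ideal_BD(2) ideal_BD(3) ideal_BD(3) n m]) simp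
qed (rule chart_ideal_B)

section \<open>The algebra \<open>A\<close> inside the polynomial ring\<close>

lemma ideal_A_eq: "ideal_A = range (\<lambda>q. (Var vx ^ 2 * Var vt + Var vy ^ 2 * Var vs + Var vx * Var vy) * q)"
  (is "_ = range (\<lambda>q. ?f * q)")
proof
  show "ideal_A \<subseteq> range (\<lambda>q. ?f * q)"
  proof (rule ideal_gen_subset)
    show "relations_A \<subseteq> range (\<lambda>q. ?f * q)"
      unfolding relations_A_def by (auto intro!: image_eqI[of _ _ 1])
    show "0 \<in> range (\<lambda>q. ?f * q)" by (auto intro!: image_eqI[of _ _ 0])
    show "a + b \<in> range (\<lambda>q. ?f * q)" if "a \<in> range (\<lambda>q. ?f * q)" "b \<in> range (\<lambda>q. ?f * q)" for a b
      using that by (auto simp flip: distrib_left)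
    show "r * a \<in> range (\<lambda>q. ?f * q)" if "a \<in> range (\<lambda>q. ?f * q)" for r a
      using that by (auto simp: mult.left_commute[of r])
  qed
  have "?f \<in> ideal_A" by (rule ideal_gen_self) (simp add: relations_A_def)
  then show "range (\<lambda>q. ?f * q) \<subseteq> ideal_A"
    using ideal_of_typeD(3)[OF ideal_gen[of relations_A]] by (auto simp: mult.commute[of ?f])
qed

text \<open>If \<open>y g = f q\<close> for the relation \<open>f\<close>, setting \<open>y = 0\<close> gives \<open>0 = x^2 t q(x, 0, t, s)\<close>, so \<open>y\<close> divides \<open>q\<close>.\<close>

lemma y_nonzerodivisor_mod_ideal_A:
  assumes "Var vy * g \<in> ideal_A"
  shows "g \<in> (ideal_A :: (var4, 'k::field) mpoly set)"
proof -
  let ?f = "Var vx ^ 2 * Var vt + Var vy ^ 2 * Var vs + Var vx * Var vy :: (var4, 'k) mpoly"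
  define e where "e = eval_mpoly Const (\<lambda>v. if v = vy then 0 else (Var v :: (var4, 'k) mpoly))"
  have he: "type_hom e" unfolding e_def by (rule type_hom_eval_mpoly[OF Const_hom])
  interpret e: type_hom e by (rule he)
  have e_gens: "e (Const c) = Const c" "e (Var v) = (if v = vy then 0 else Var v)" for c v
    by (simp_all add: e_def Const_hom)
  \<comment> \<open>\<open>e\<close> sets \<open>y\<close> to zero, so it changes a polynomial by a multiple of \<open>y\<close>.\<close>
  have taylor: "\<exists>r. p = e p + Var vy * r" for p
  proof (induction p rule: mpoly_induct)
    case (Const c)
    show ?case by (rule exI[of _ 0]) (simp add: e_gens)
  next
    case (Var v)
    show ?case by (rule exI[of _ "if v = vy then 1 else 0"]) (simp add: e_gens)
  next
    case (add p q)
    then obtain r s where "p = e p + Var vy * r" "q = e q + Var vy * s" by blast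
    then have "p + q = e (p + q) + Var vy * (r + s)" by (metis (no_types, lifting) e.add add.assoc add.left_commute distrib_left)
    then show ?case by blast
  next
    case (mult p q)
    then obtain r s where rs: "p = e p + Var vy * r" "q = e q + Var vy * s" by blast
    have "p * q = (e p + Var vy * r) * (e q + Var vy * s)" using rs by metis
    also have "\<dots> = e (p * q) + Var vy * (e p * s + r * e q + Var vy * r * s)"
      by (simp add: e.mult algebra_simps)
    finally show ?case by blast
  qed
  have cancel: "Var v * p = 0 \<Longrightarrow> p = 0" for v and p :: "(var4, 'k) mpoly"
    unfolding Var_def by (rule monomial_mult_eq_0)
  from assms obtain q where q: "Var vy * g = ?f * q" unfolding ideal_A_eq by blast
  have "e (Var vy * g) = e (?f * q)" using q by simp
  then have "Var vx * (Var vx * (Var vt * e q)) = 0"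
    by (simp add: e.hom_simps e_gens power2_eq_square mult.assoc)
  then have "e q = 0" using cancel by blast
  with taylor[of q] obtain r where "q = Var vy * r" by auto
  with q have "Var vy * (g - ?f * r) = 0" by (simp add: algebra_simps)
  then have "g = ?f * r" using cancel by fastforce
  then show ?thesis unfolding ideal_A_eq by blast
qed

text \<open>Rabinowitsch's trick with \<open>h = y\<close>: where \<open>Z\<close> inverts \<open>y\<close>, the parameter \<open>w = x / y\<close> is \<open>x Z\<close>.\<close>

lemma chart_incl_AB_kernel: "chart (incl_AB a) = 0 \<longleftrightarrow> a \<in> (ideal_A :: (var4, 'k::field) mpoly set)"
proof
  let ?x = "Var vx :: (var4, 'k) mpoly" and ?y = "Var vy :: (var4, 'k) mpoly"
    and ?t = "Var vt :: (var4, 'k) mpoly" and ?s = "Var vs :: (var4, 'k) mpoly"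
  assume "chart (incl_AB a) = 0"
  moreover have "type_hom (\<lambda>a :: (var4, 'k) mpoly. chart (incl_AB a))"
    by (rule type_hom_comp[OF type_hom_incl_AB type_hom_chart])
  ultimately have "\<exists>n. ?y ^ n * a \<in> ideal_A"
  proof (intro localization_kernel[of ideal_A "\<lambda>a. chart (incl_AB a)", OF ideal_gen])
    let ?\<kappa> = "\<lambda>c. [:Const c:] :: (var4, 'k) mpoly poly"
    let ?\<Psi> = "eval3 ?\<kappa> [:0, ?x:] [:?y:] [:?t:]"
    have \<kappa>: "type_hom ?\<kappa>" using Const_hom type_hom_const_poly by (rule type_hom_comp)
    show \<Psi>: "type_hom ?\<Psi>" by (rule eval3(1)[OF \<kappa>])
    interpret \<Psi>: type_hom ?\<Psi> by (rule \<Psi>)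
    show "?\<Psi> (chart (incl_AB (Const c))) = [:Const c:]" for c by (simp add: eval3[OF \<kappa>])
    have J0: "0 \<in> (ideal_A :: (var4, 'k) mpoly set)" by (rule ideal_of_typeD(1)[OF ideal_gen])
    have f: "?x ^ 2 * ?t + ?y ^ 2 * ?s + ?x * ?y \<in> ideal_A"
      by (rule ideal_gen_self) (simp add: relations_A_def)
    note [simp] = chart.hom_simps \<Psi>.hom_simps eval3(2-5)[OF \<kappa>]
    have witness: "\<exists>c. \<forall>i. Polynomial.coeff ([:Var v:] - ?\<Psi> (chart (incl_AB (Var v))) - c * [:- 1, ?y:]) i \<in> ideal_A"
      if "[:Var v:] - ?\<Psi> (chart (incl_AB (Var v))) - c * [:- 1, ?y:] = [:0, 0, d:]" "d \<in> ideal_A" for v c d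
      by (rule exI[of _ c]) (use that J0 in \<open>auto simp: coeff_pCons split: nat.splits\<close>)
    fix v show "\<exists>c. \<forall>i. Polynomial.coeff ([:Var v:] - ?\<Psi> (chart (incl_AB (Var v))) - c * [:- 1, ?y:]) i \<in> ideal_A"
    proof (cases v)
      case [simp]: vx
      show ?thesis by (rule witness[of v "[:- ?x:]" 0]) (simp_all add: J0 algebra_simps)
    next
      case [simp]: vy
      show ?thesis by (rule witness[of v 0 0]) (simp_all add: J0)
    next
      case [simp]: vt
      show ?thesis by (rule witness[of v 0 0]) (simp_all add: J0)
    next
      case [simp]: vs
      show ?thesis
        by (rule witness[of v "[:- ?s, - ?x - ?y * ?s:]", OF _ f])
           (simp_all add: algebra_simps power2_eq_square)
    qed
  qed
  then obtain n where "?y ^ n * a \<in> ideal_A" by blast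
  then show "a \<in> ideal_A"
    by (induction n) (auto simp: mult.assoc intro: y_nonzerodivisor_mod_ideal_A)
next
  assume "a \<in> ideal_A"
  then obtain q where "a = (Var vx ^ 2 * Var vt + Var vy ^ 2 * Var vs + Var vx * Var vy) * q"
    unfolding ideal_A_eq by blast
  then show "chart (incl_AB a) = 0"
    by (simp add: chart.hom_simps incl_AB.hom_simps algebra_simps power2_eq_square)
qed

section \<open>Integral fractions belong to \<open>B\<close>\<close>

text \<open>Together with the kernel, this shows that \<open>P\<close> and \<open>B\<close> agree after inverting \<open>U + 1\<close>.  For \<open>w\<close> it
is the equation \<open>(U + 1) w = - S\<close>.\<close>

lemma chart_localization_surj: "\<exists>n b. (varw * vart + 1) ^ n * r = chart b"
proof (induction r rule: poly3_induct)
  case (const c)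
  show ?case by (rule exI[of _ 0], rule exI[of _ "Const c"]) simp
next
  case w
  show ?case
    by (rule exI[of _ 1], rule exI[of _ "- Var vS"]) (simp add: chart.hom_simps algebra_simps)
next
  case y
  show ?case by (rule exI[of _ 0], rule exI[of _ "Var vY"]) simp
next
  case t
  show ?case by (rule exI[of _ 0], rule exI[of _ "Var vT"]) simp
next
  case (add p q)
  then obtain n b m c where "(varw * vart + 1) ^ n * p = chart b" "(varw * vart + 1) ^ m * q = chart c"
    by blast
  note nm = this
  define h where "h = (varw * vart + 1 :: 'a poly3)"
  have "h ^ (n + m) * (p + q) = h ^ m * (h ^ n * p) + h ^ n * (h ^ m * q)"
    by (simp add: power_add algebra_simps)
  also have "\<dots> = h ^ m * chart b + h ^ n * chart c"
    using nm by (simp only: h_def)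
  also have "\<dots> = chart ((Var vU + 1) ^ m * b + (Var vU + 1) ^ n * c)"
    by (simp add: chart.hom_simps h_def)
  finally show ?case unfolding h_def by blast
next
  case (mult p q)
  then obtain n b m c where "(varw * vart + 1) ^ n * p = chart b" "(varw * vart + 1) ^ m * q = chart c"
    by blast
  then have "((varw * vart + 1) ^ n * p) * ((varw * vart + 1) ^ m * q) = chart (b * c)"
    by (simp only: chart.mult)
  then have "(varw * vart + 1) ^ (n + m) * (p * q) = chart (b * c)"
    by (simp only: power_add mult_ac)
  then show ?case by blast
qed

lemma integral_fraction_localized:
  assumes "chart (a ^ length l + q * horner a q l) = 0" "chart q \<noteq> 0"
  shows "\<exists>n b. chart ((Var vU + 1) ^ n * a) = chart (q * b)"
proof -
  have "chart a ^ length (map chart l) + chart q * horner (chart a) (chart q) (map chart l) = 0"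
    using assms(1) by (simp add: chart.hom_simps chart.hom_horner)
  from poly3_integrally_closed[OF this assms(2)]
  obtain r where r: "chart a = chart q * r" by (elim dvdE)
  from chart_localization_surj[of r] obtain n b where "(varw * vart + 1) ^ n * r = chart b" by blast
  then have b: "chart ((Var vU + 1) ^ n) * r = chart b" by (simp add: chart.hom_simps)
  have "chart ((Var vU + 1) ^ n * a) = chart q * (chart ((Var vU + 1) ^ n) * r)"
    unfolding chart.mult r by (rule mult.left_commute)
  then have "chart ((Var vU + 1) ^ n * a) = chart (q * b)" unfolding b chart.mult .
  then show ?thesis by blast
qed

text \<open>The first chart shows \<open>(U + 1)^n a \<in> q B\<close>.  The same argument for the images under \<open>swap\<close> shows
\<open>(- U)^m a \<in> q B\<close>, because \<open>swap\<close> maps \<open>U + 1\<close> to \<open>- U\<close>.\<close>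

lemma integral_fraction_in_B:
  fixes a q :: "(var4, 'k::field) mpoly"
  assumes eq: "chart (incl_AB (a ^ length l + q * horner a q l)) = 0" and q: "chart (incl_AB q) \<noteq> 0"
  shows "\<exists>b. chart (incl_AB q) * chart b = chart (incl_AB a)"
proof -
  let ?a = "incl_AB a" and ?q = "incl_AB q" and ?l = "map incl_AB l"
  let ?e = "?a ^ length ?l + ?q * horner ?a ?q ?l"
  have e: "chart ?e = 0"
    using eq by (simp add: incl_AB.hom_simps incl_AB.hom_horner)
  from integral_fraction_localized[OF e q] obtain n b
    where b: "chart ((Var vU + 1) ^ n * ?a) = chart (?q * b)" by blast
  have se: "chart (swap ?a ^ length (map swap ?l)
      + swap ?q * horner (swap ?a) (swap ?q) (map swap ?l)) = 0"
    using chart_swap_zero[OF e] by (simp add: swap.hom_simps swap.hom_horner del: map_map)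
  have sq: "chart (swap ?q) \<noteq> 0"
    using chart_swap_zero[of "swap ?q"] q by auto
  from integral_fraction_localized[OF se sq]
  obtain m c where "chart ((Var vU + 1) ^ m * swap ?a) = chart (swap ?q * c)" by blast
  then have "chart ((Var vU + 1) ^ m * swap ?a - swap ?q * c) = 0" by (simp add: chart.diff)
  from chart_swap_zero[OF this]
  have c: "chart ((- Var vU) ^ m * ?a) = chart (?q * swap c)"
    by (simp add: swap.hom_simps chart.diff)
  let ?M = "{x. \<exists>b. x = chart (?q * b)}"
  have "chart ?a \<in> ?M"
  proof (rule comaximal_powers[where a = "chart (Var vU + 1)" and b = "chart (- Var vU)"
          and M = ?M and n = n and m = m])
    show "chart (Var vU + 1) + chart (- Var vU) = 1"
      by (simp add: chart.hom_simps)
    show "x + y \<in> ?M" if "x \<in> ?M" "y \<in> ?M" for x y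
    proof -
      from that obtain b b' where "x = chart (?q * b)" "y = chart (?q * b')" by blast
      then have "x + y = chart (?q * (b + b'))" by (simp only: distrib_left chart.add)
      then show ?thesis by blast
    qed
    have M_mult: "chart r * x \<in> ?M" if "x \<in> ?M" for r x
    proof -
      from that obtain b where "x = chart (?q * b)" by blast
      then have "chart r * x = chart (?q * (r * b))" by (simp only: chart.mult mult_ac)
      then show ?thesis by blast
    qed
    show "chart (Var vU + 1) * x \<in> ?M" "chart (- Var vU) * x \<in> ?M" if "x \<in> ?M" for x
      by (rule M_mult[OF that])+
    show "chart (Var vU + 1) ^ n * chart ?a \<in> ?M" "chart (- Var vU) ^ m * chart ?a \<in> ?M"
      using b c by (auto simp only: chart.mult chart.power mem_Collect_eq)
  qed
  then obtain b where "chart ?a = chart (?q * b)" by blast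
  then show ?thesis unfolding chart.mult by metis
qed

text \<open>The equation \<open>u^2 = - u - t s\<close> makes \<open>A + A u\<close> closed under multiplication.\<close>

lemma chart_module_basis:
  "\<exists>a c. chart b = chart (incl_AB a) + chart (incl_AB c) * (varw * vart)"
proof (induction b rule: mpoly_induct)
  case (Const k)
  show ?case by (rule exI[of _ "Const k"], rule exI[of _ 0]) (simp add: incl_AB.zero chart.zero)
next
  case (Var v)
  note [simp] = incl_AB.zero chart.zero incl_AB.one chart.one
  show ?case
  proof (cases v)
    case [simp]: vX
    show ?thesis by (rule exI[of _ "Var vx"], rule exI[of _ 0]) simp
  next
    case [simp]: vY
    show ?thesis by (rule exI[of _ "Var vy"], rule exI[of _ 0]) simp
  next
    case [simp]: vT
    show ?thesis by (rule exI[of _ "Var vt"], rule exI[of _ 0]) simp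
  next
    case [simp]: vS
    show ?thesis by (rule exI[of _ "Var vs"], rule exI[of _ 0]) simp
  next
    case [simp]: vU
    show ?thesis by (rule exI[of _ 0], rule exI[of _ 1]) simp
  qed
next
  case (add p q)
  then obtain a c a' c' where "chart p = chart (incl_AB a) + chart (incl_AB c) * (varw * vart)"
    "chart q = chart (incl_AB a') + chart (incl_AB c') * (varw * vart)" by blast
  then have "chart (p + q) = chart (incl_AB (a + a')) + chart (incl_AB (c + c')) * (varw * vart)"
    by (simp add: incl_AB.add chart.add algebra_simps)
  then show ?case by blast
next
  case (mult p q)
  then obtain a c a' c' where *: "chart p = chart (incl_AB a) + chart (incl_AB c) * (varw * vart)"
    "chart q = chart (incl_AB a') + chart (incl_AB c') * (varw * vart)" by blast
  have "chart (p * q) = chart (incl_AB (a * a' - c * c' * Var vt * Var vs))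
      + chart (incl_AB (a * c' + a' * c - c * c')) * (varw * vart)"
    by (simp add: * incl_AB.hom_simps chart.hom_simps algebra_simps)
  then show ?case by blast
qed

text \<open>Elements of \<open>B\<close> are fractions over \<open>A\<close> with denominator \<open>y\<close>, since \<open>y u = x t\<close>.\<close>

lemma chart_fraction: "\<exists>a. chart (incl_AB (Var vy)) * chart b = chart (incl_AB a)"
proof -
  obtain a c where "chart b = chart (incl_AB a) + chart (incl_AB c) * (varw * vart)"
    using chart_module_basis by blast
  then have "chart (incl_AB (Var vy)) * chart b = chart (incl_AB (Var vy * a + Var vx * Var vt * c))"
    by (simp add: incl_AB.hom_simps chart.hom_simps algebra_simps)
  then show ?thesis by blast
qed

text \<open>The conjugate of \<open>u\<close> is \<open>- 1 - u\<close>, so \<open>a + c u\<close> and its conjugate \<open>a - c - c u\<close> have the sum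
\<open>2 a - c\<close> and the product \<open>a^2 - a c + c^2 t s\<close>.\<close>

lemma chart_quadratic: "\<exists>c d. chart b ^ 2 + chart (incl_AB c) * chart b + chart (incl_AB d) = 0"
proof -
  obtain a c where b: "chart b = chart (incl_AB a) + chart (incl_AB c) * (varw * vart)"
    using chart_module_basis by blast
  have "chart b ^ 2 + chart (incl_AB (c - a - a)) * chart b
      + chart (incl_AB (a ^ 2 - a * c + c ^ 2 * Var vt * Var vs)) = 0"
    by (simp only: b incl_AB.hom_simps chart.hom_simps chart_gens incl_AB_gens power2_eq_square)
       (simp add: algebra_simps)
  then show ?thesis by blast
qed

section \<open>The fraction field of \<open>A\<close>\<close>

abbreviation chartA :: "(var4, 'k::field) mpoly \<Rightarrow> 'k poly3" where
  "chartA a \<equiv> chart (incl_AB a)"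

abbreviation ring_A :: "(var4, 'k::field) mpoly set ring" where
  "ring_A \<equiv> affine_algebra relations_A"

abbreviation ring_B :: "(var5, 'k::field) mpoly set ring" where
  "ring_B \<equiv> affine_algebra relations_B"

abbreviation frac_A :: "((var4, 'k::field) mpoly set \<times> (var4, 'k) mpoly set) set ring" where
  "frac_A \<equiv> fraction_field ring_A"

definition coset_map :: "('v, 'k::field) mpoly set \<Rightarrow> ('v, 'k) mpoly \<Rightarrow> ('v, 'k) mpoly set" where
  "coset_map F p = ideal_gen F +>\<^bsub>mpoly_ring\<^esub> p"

lemma type_ring_simps [simp]:
  "carrier ring_of_type_algebra = UNIV" "x \<otimes>\<^bsub>ring_of_type_algebra\<^esub> y = x * y"
  "x \<oplus>\<^bsub>ring_of_type_algebra\<^esub> y = x + y" "\<one>\<^bsub>ring_of_type_algebra\<^esub> = 1"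
  "\<zero>\<^bsub>ring_of_type_algebra\<^esub> = 0"
  by (simp_all add: ring_of_type_algebra_def)

lemma coset_map_ring_hom: "coset_map F \<in> ring_hom mpoly_ring (affine_algebra F)"
  unfolding coset_map_def affine_algebra_def by (rule ideal.rcos_ring_hom[OF ideal_gen])

lemma affine_algebra_cring: "cring (affine_algebra F)"
  unfolding affine_algebra_def by (rule ideal.quotient_is_cring[OF ideal_gen cring_from_type_algebra])

lemma carrier_affine_algebra: "carrier (affine_algebra F) = range (coset_map F)"
  by (auto simp: affine_algebra_def FactRing_def A_RCOSETS_def' coset_map_def)

lemma coset_map_eq_iff: "coset_map F p = coset_map F q \<longleftrightarrow> p - q \<in> ideal_gen F"
proof -
  interpret R: cring "mpoly_ring :: ('a, 'b) mpoly ring" by (rule cring_from_type_algebra)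
  have "\<ominus>\<^bsub>mpoly_ring\<^esub> q = - q"
    by (rule R.minus_equality) simp_all
  then have "p \<ominus>\<^bsub>mpoly_ring\<^esub> q = p - q" by (simp add: a_minus_def)
  then show ?thesis
    using R.quotient_eq_iff_same_a_r_cos[OF ideal_gen, of p q F] by (simp add: coset_map_def)
qed

lemma coset_map_simps:
  "coset_map F p \<in> carrier (affine_algebra F)"
  "coset_map F (p + q) = coset_map F p \<oplus>\<^bsub>affine_algebra F\<^esub> coset_map F q"
  "coset_map F (p * q) = coset_map F p \<otimes>\<^bsub>affine_algebra F\<^esub> coset_map F q"
  "coset_map F 1 = \<one>\<^bsub>affine_algebra F\<^esub>"
  using ring_hom_closed[OF coset_map_ring_hom[of F], of p] ring_hom_add[OF coset_map_ring_hom[of F], of p q]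
    ring_hom_mult[OF coset_map_ring_hom[of F], of p q] ring_hom_one[OF coset_map_ring_hom[of F]]
  by simp_all

lemma coset_map_zero: "coset_map F 0 = \<zero>\<^bsub>affine_algebra F\<^esub>"
proof -
  interpret cring "affine_algebra F" by (rule affine_algebra_cring)
  have "coset_map F 0 \<oplus>\<^bsub>affine_algebra F\<^esub> coset_map F 0 = coset_map F 0"
    by (simp flip: coset_map_simps(2))
  then show ?thesis using coset_map_simps(1) by (metis add.l_cancel_one)
qed

lemma affine_scalar_eq: "affine_scalar F c = coset_map F (Const c)"
  by (simp add: affine_scalar_def coset_map_def)

lemma coset_A_eq_iff: "coset_map relations_A a = coset_map relations_A b \<longleftrightarrow> chartA a = chartA b"
  by (simp add: coset_map_eq_iff chart.diff incl_AB.diff flip: chart_incl_AB_kernel)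

lemma coset_B_eq_iff: "coset_map relations_B a = coset_map relations_B b \<longleftrightarrow> chart a = chart b"
  by (simp add: coset_map_eq_iff chart.diff flip: chart_kernel)

lemma coset_A_eq_zero_iff: "coset_map relations_A a = \<zero>\<^bsub>ring_A\<^esub> \<longleftrightarrow> chartA a = 0"
  using coset_A_eq_iff[of a 0] by (simp add: coset_map_zero incl_AB.zero chart.zero)

lemma domain_A: "domain (ring_A :: (var4, 'k::field) mpoly set ring)"
proof (rule domain.intro)
  show "cring (ring_A :: (var4, 'k) mpoly set ring)" by (rule affine_algebra_cring)
  show "domain_axioms (ring_A :: (var4, 'k) mpoly set ring)"
  proof
    show "\<one>\<^bsub>ring_A\<^esub> \<noteq> (\<zero>\<^bsub>ring_A\<^esub> :: (var4, 'k) mpoly set)"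
      unfolding coset_map_simps(4)[symmetric] coset_A_eq_zero_iff incl_AB.one chart.one
      by (rule one_neq_zero)
    fix x y :: "(var4, 'k) mpoly set"
    assume "x \<otimes>\<^bsub>ring_A\<^esub> y = \<zero>\<^bsub>ring_A\<^esub>" "x \<in> carrier ring_A" "y \<in> carrier ring_A"
    then obtain a b where xy: "x = coset_map relations_A a" "y = coset_map relations_A b"
      and 0: "coset_map relations_A (a * b) = \<zero>\<^bsub>ring_A\<^esub>"
      unfolding carrier_affine_algebra coset_map_simps(3) by blast
    from 0 have "chartA a * chartA b = 0"
      unfolding coset_A_eq_zero_iff incl_AB.mult chart.mult .
    then show "x = \<zero>\<^bsub>ring_A\<^esub> \<or> y = \<zero>\<^bsub>ring_A\<^esub>"
      unfolding xy coset_A_eq_zero_iff by simp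
  qed
qed

interpretation A: domain "ring_A :: (var4, 'k::field) mpoly set ring" by (rule domain_A)
interpretation F: domain "frac_A :: ((var4, 'k::field) mpoly set \<times> (var4, 'k) mpoly set) set ring"
  by (rule field.axioms(1)[OF A.fraction_field_is_field])

definition frac_map :: "(var4, 'k::field) mpoly \<Rightarrow> ((var4, 'k) mpoly set \<times> (var4, 'k) mpoly set) set" where
  "frac_map a = to_frac ring_A (coset_map relations_A a)"

lemma frac_map_simps:
  "frac_map a \<in> carrier frac_A"
  "frac_map (a + b) = frac_map a \<oplus>\<^bsub>frac_A\<^esub> frac_map b"
  "frac_map (a * b) = frac_map a \<otimes>\<^bsub>frac_A\<^esub> frac_map b"
  "frac_map 1 = \<one>\<^bsub>frac_A\<^esub>" "frac_map 0 = \<zero>\<^bsub>frac_A\<^esub>"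
  unfolding frac_map_def coset_map_simps coset_map_zero
  by (simp_all add: coset_map_simps ring_hom_closed[OF A.to_frac_hom] ring_hom_add[OF A.to_frac_hom]
      ring_hom_mult[OF A.to_frac_hom] ring_hom_one[OF A.to_frac_hom]
      ring_hom_zero[OF A.to_frac_hom A.ring_axioms F.ring_axioms])

lemma frac_map_power: "frac_map (a ^ n) = frac_map a [^]\<^bsub>frac_A\<^esub> n"
  by (induction n) (simp_all add: frac_map_simps F.m_comm)

lemma frac_map_eq_iff: "frac_map a = frac_map b \<longleftrightarrow> chartA a = chartA b"
  using inj_on_eq_iff[OF A.to_frac_inj, of "coset_map relations_A a" "coset_map relations_A b"]
  by (simp add: frac_map_def coset_map_simps coset_A_eq_iff)

lemma frac_map_nonzero: "frac_map a \<noteq> \<zero>\<^bsub>frac_A\<^esub> \<longleftrightarrow> chartA a \<noteq> 0"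
  using frac_map_eq_iff[of a 0] by (simp add: frac_map_simps incl_AB.zero chart.zero)

lemma frac_A_cases:
  assumes "z \<in> carrier frac_A"
  obtains a q where "chartA q \<noteq> 0" "frac_map q \<otimes>\<^bsub>frac_A\<^esub> z = frac_map a"
proof -
  from assms obtain x y where z: "z = frac_class ring_A x y" "x \<in> carrier ring_A" "y \<in> carrier ring_A" "y \<noteq> \<zero>\<^bsub>ring_A\<^esub>"
    by (rule A.frac_cases)
  then obtain a q where aq: "x = coset_map relations_A a" "y = coset_map relations_A q"
    by (auto simp: carrier_affine_algebra)
  have "frac_map q \<otimes>\<^bsub>frac_A\<^esub> z = frac_map a"
    using z unfolding frac_map_def to_frac_def aq
    by (simp add: A.frac_mult A.frac_eq_iff A.m_comm)
  moreover have "chartA q \<noteq> 0" using z aq by (simp add: coset_A_eq_zero_iff)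
  ultimately show ?thesis using that by blast
qed

text \<open>Clearing denominators in the value of a polynomial at the fraction \<open>z = a / q\<close>.\<close>

lemma eval_horner:
  assumes z: "z \<in> carrier frac_A" "frac_map q \<otimes>\<^bsub>frac_A\<^esub> z = frac_map a"
  shows "F.eval (map frac_map l) z \<in> carrier frac_A"
    and "frac_map q [^]\<^bsub>frac_A\<^esub> length l \<otimes>\<^bsub>frac_A\<^esub> F.eval (map frac_map l) z
      = frac_map (q * horner a q l)"
proof -
  note [simp] = frac_map_simps(1) z(1)
  have pow: "frac_map q [^]\<^bsub>frac_A\<^esub> n \<otimes>\<^bsub>frac_A\<^esub> z [^]\<^bsub>frac_A\<^esub> n = frac_map (a ^ n)" for n :: nat
    using F.nat_pow_distrib[of "frac_map q" z n] z by (simp add: frac_map_power)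
  show cl: "F.eval (map frac_map l) z \<in> carrier frac_A" for l
    by (induction l) simp_all
  show "frac_map q [^]\<^bsub>frac_A\<^esub> length l \<otimes>\<^bsub>frac_A\<^esub> F.eval (map frac_map l) z
      = frac_map (q * horner a q l)"
  proof (induction l)
    case Nil
    show ?case by (simp add: frac_map_simps)
  next
    case (Cons c l)
    let ?n = "length l" and ?q = "frac_map q" and ?e = "F.eval (map frac_map l) z"
    note [simp] = cl
    have "?q [^]\<^bsub>frac_A\<^esub> Suc ?n \<otimes>\<^bsub>frac_A\<^esub> (frac_map c \<otimes>\<^bsub>frac_A\<^esub> z [^]\<^bsub>frac_A\<^esub> ?n \<oplus>\<^bsub>frac_A\<^esub> ?e)
        = ?q \<otimes>\<^bsub>frac_A\<^esub> (frac_map c \<otimes>\<^bsub>frac_A\<^esub> (?q [^]\<^bsub>frac_A\<^esub> ?n \<otimes>\<^bsub>frac_A\<^esub> z [^]\<^bsub>frac_A\<^esub> ?n)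
          \<oplus>\<^bsub>frac_A\<^esub> ?q [^]\<^bsub>frac_A\<^esub> ?n \<otimes>\<^bsub>frac_A\<^esub> ?e)"
      by (simp add: F.r_distr F.m_ac)
    also have "\<dots> = frac_map (q * horner a q (c # l))"
      unfolding pow Cons.IH by (simp add: frac_map_simps)
    finally show ?case by simp
  qed
qed

lemma integral_equation:
  assumes z: "z \<in> carrier frac_A" "frac_map q \<otimes>\<^bsub>frac_A\<^esub> z = frac_map a"
    and int: "integral_over frac_A (to_frac ring_A ` carrier ring_A) z"
  shows "\<exists>l. chartA (a ^ length l + q * horner a q l) = 0"
proof -
  have img: "to_frac ring_A ` carrier ring_A = range frac_map"
    by (auto simp: carrier_affine_algebra frac_map_def)
  from int obtain p where p: "polynomial\<^bsub>frac_A\<^esub> (range frac_map) p" "p \<noteq> []"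
    "hd p = \<one>\<^bsub>frac_A\<^esub>" "F.eval p z = \<zero>\<^bsub>frac_A\<^esub>"
    unfolding integral_over_def img by blast
  then have "set (tl p) \<subseteq> range frac_map"
    by (cases p) (auto simp: polynomial_def)
  then have "tl p \<in> lists (range frac_map)" by (simp add: lists_eq_set)
  then obtain l where l: "tl p = map frac_map l"
    unfolding lists_image by (elim imageE)
  note [simp] = frac_map_simps(1) z(1) eval_horner(1)[OF z]
  have "p = \<one>\<^bsub>frac_A\<^esub> # map frac_map l" using p l by (cases p) auto
  with p have "z [^]\<^bsub>frac_A\<^esub> length l \<oplus>\<^bsub>frac_A\<^esub> F.eval (map frac_map l) z = \<zero>\<^bsub>frac_A\<^esub>" by simp
  then have "frac_map q [^]\<^bsub>frac_A\<^esub> length l \<otimes>\<^bsub>frac_A\<^esub>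
      (z [^]\<^bsub>frac_A\<^esub> length l \<oplus>\<^bsub>frac_A\<^esub> F.eval (map frac_map l) z) = \<zero>\<^bsub>frac_A\<^esub>" by simp
  then have "frac_map (a ^ length l + q * horner a q l) = frac_map 0"
    using F.nat_pow_distrib[of "frac_map q" z "length l"]
    by (simp add: F.r_distr eval_horner(2)[OF z] z(2) frac_map_simps(2,5) frac_map_power)
  then show ?thesis unfolding frac_map_eq_iff by (auto simp: incl_AB.zero chart.zero)
qed

section \<open>The normalization of \<open>A\<close>\<close>

text \<open>The graph of the isomorphism from the integral closure to \<open>B\<close>: a fraction \<open>a / q\<close> corresponds to \<open>b\<close>
if \<open>q b = a\<close> holds in the common overring \<open>P\<close>.  The second component is a representative, so that \<open>b\<close> is
determined up to the ideal of \<open>B\<close> only.\<close>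

definition same_fraction where
  "same_fraction z b \<longleftrightarrow> z \<in> carrier frac_A \<and>
     (\<exists>a q. chartA q \<noteq> 0 \<and> frac_map q \<otimes>\<^bsub>frac_A\<^esub> z = frac_map a \<and> chartA q * chart b = chartA a)"

text \<open>The relation is well-defined and injective at once: both sides become the equation \<open>q' a = q a'\<close>
after cross-multiplication, and \<open>A\<close> embeds into \<open>P\<close>.\<close>

lemma same_fraction_unique:
  assumes "same_fraction z b" "same_fraction z' b'"
  shows "z = z' \<longleftrightarrow> chart b = chart b'"
proof -
  from assms obtain a q a' q' where 1: "z \<in> carrier frac_A" "chartA q \<noteq> 0"
      "frac_map q \<otimes>\<^bsub>frac_A\<^esub> z = frac_map a" "chartA q * chart b = chartA a"
    and 2: "z' \<in> carrier frac_A" "chartA q' \<noteq> 0"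
      "frac_map q' \<otimes>\<^bsub>frac_A\<^esub> z' = frac_map a'" "chartA q' * chart b' = chartA a'"
    unfolding same_fraction_def by blast
  note [simp] = frac_map_simps(1) 1(1) 2(1)
  have "z = z' \<longleftrightarrow> frac_map (q * q') \<otimes>\<^bsub>frac_A\<^esub> z = frac_map (q * q') \<otimes>\<^bsub>frac_A\<^esub> z'"
    using F.m_lcancel[of "frac_map (q * q')" z z'] 1(2) 2(2)
    by (simp add: frac_map_nonzero incl_AB.mult chart.mult)
  also have "frac_map (q * q') \<otimes>\<^bsub>frac_A\<^esub> z = frac_map q' \<otimes>\<^bsub>frac_A\<^esub> (frac_map q \<otimes>\<^bsub>frac_A\<^esub> z)"
    by (simp add: frac_map_simps F.m_ac)
  also have "\<dots> = frac_map (q' * a)" by (simp add: 1 frac_map_simps)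
  also have "frac_map (q * q') \<otimes>\<^bsub>frac_A\<^esub> z' = frac_map q \<otimes>\<^bsub>frac_A\<^esub> (frac_map q' \<otimes>\<^bsub>frac_A\<^esub> z')"
    by (simp add: frac_map_simps F.m_ac)
  also have "\<dots> = frac_map (q * a')" by (simp add: 2 frac_map_simps)
  also have "frac_map (q' * a) = frac_map (q * a') \<longleftrightarrow> chartA q' * (chartA q * chart b) = chartA q * (chartA q' * chart b')"
    by (simp add: frac_map_eq_iff incl_AB.mult chart.mult 1 2)
  also have "\<dots> \<longleftrightarrow> (chartA q * chartA q') * chart b = (chartA q * chartA q') * chart b'"
    by (simp only: mult_ac)
  also have "\<dots> \<longleftrightarrow> chart b = chart b'" using 1(2) 2(2) by simp
  finally show ?thesis .
qed

lemma same_fraction_add: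
  assumes "same_fraction z b" "same_fraction z' b'"
  shows "same_fraction (z \<oplus>\<^bsub>frac_A\<^esub> z') (b + b')"
proof -
  from assms obtain a q a' q' where 1: "z \<in> carrier frac_A" "chartA q \<noteq> 0"
      "frac_map q \<otimes>\<^bsub>frac_A\<^esub> z = frac_map a" "chartA q * chart b = chartA a"
    and 2: "z' \<in> carrier frac_A" "chartA q' \<noteq> 0"
      "frac_map q' \<otimes>\<^bsub>frac_A\<^esub> z' = frac_map a'" "chartA q' * chart b' = chartA a'"
    unfolding same_fraction_def by blast
  note [simp] = frac_map_simps(1) 1(1) 2(1)
  have "frac_map (q * q') \<otimes>\<^bsub>frac_A\<^esub> (z \<oplus>\<^bsub>frac_A\<^esub> z')
      = frac_map q' \<otimes>\<^bsub>frac_A\<^esub> (frac_map q \<otimes>\<^bsub>frac_A\<^esub> z) \<oplus>\<^bsub>frac_A\<^esub> frac_map q \<otimes>\<^bsub>frac_A\<^esub> (frac_map q' \<otimes>\<^bsub>frac_A\<^esub> z')"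
    by (simp add: frac_map_simps F.r_distr F.m_ac)
  also have "\<dots> = frac_map (q' * a + q * a')" by (simp add: 1 2 frac_map_simps)
  finally have "frac_map (q * q') \<otimes>\<^bsub>frac_A\<^esub> (z \<oplus>\<^bsub>frac_A\<^esub> z') = frac_map (q' * a + q * a')" .
  moreover have "chartA (q * q') * chart (b + b') = chartA (q' * a + q * a')"
    by (simp add: incl_AB.mult chart.mult incl_AB.add chart.add algebra_simps flip: 1(4) 2(4))
  moreover have "chartA (q * q') \<noteq> 0" using 1 2 by (simp add: incl_AB.mult chart.mult)
  ultimately show ?thesis unfolding same_fraction_def by auto
qed

lemma same_fraction_mult:
  assumes "same_fraction z b" "same_fraction z' b'"
  shows "same_fraction (z \<otimes>\<^bsub>frac_A\<^esub> z') (b * b')"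
proof -
  from assms obtain a q a' q' where 1: "z \<in> carrier frac_A" "chartA q \<noteq> 0"
      "frac_map q \<otimes>\<^bsub>frac_A\<^esub> z = frac_map a" "chartA q * chart b = chartA a"
    and 2: "z' \<in> carrier frac_A" "chartA q' \<noteq> 0"
      "frac_map q' \<otimes>\<^bsub>frac_A\<^esub> z' = frac_map a'" "chartA q' * chart b' = chartA a'"
    unfolding same_fraction_def by blast
  note [simp] = frac_map_simps(1) 1(1) 2(1)
  have "frac_map (q * q') \<otimes>\<^bsub>frac_A\<^esub> (z \<otimes>\<^bsub>frac_A\<^esub> z')
      = (frac_map q \<otimes>\<^bsub>frac_A\<^esub> z) \<otimes>\<^bsub>frac_A\<^esub> (frac_map q' \<otimes>\<^bsub>frac_A\<^esub> z')"
    by (simp add: frac_map_simps F.m_ac)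
  also have "\<dots> = frac_map (a * a')" by (simp add: 1 2 frac_map_simps)
  finally have "frac_map (q * q') \<otimes>\<^bsub>frac_A\<^esub> (z \<otimes>\<^bsub>frac_A\<^esub> z') = frac_map (a * a')" .
  moreover have "chartA (q * q') * chart (b * b') = chartA (a * a')"
    by (simp add: incl_AB.mult chart.mult mult_ac flip: 1(4) 2(4))
  moreover have "chartA (q * q') \<noteq> 0" using 1 2 by (simp add: incl_AB.mult chart.mult)
  ultimately show ?thesis unfolding same_fraction_def by auto
qed

lemma same_fraction_frac_map: "same_fraction (frac_map a) (incl_AB a)"
  unfolding same_fraction_def
  by (intro conjI exI[of _ a] exI[of _ 1])
     (simp_all add: frac_map_simps incl_AB.one chart.one)

lemma ex_same_fraction:
  fixes b :: "(var5, 'k::field) mpoly"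
  shows "\<exists>z. same_fraction z b"
proof -
  obtain a where a: "chartA (Var vy) * chart b = chartA a" using chart_fraction by blast
  let ?y = "frac_map (Var vy :: (var4, 'k) mpoly)"
  have y: "chartA (Var vy :: (var4, 'k) mpoly) \<noteq> 0" by (simp add: vars_nonzero)
  then have "?y \<in> Units frac_A" by (simp add: field.field_Units[OF A.fraction_field_is_field] frac_map_simps(1) frac_map_nonzero)
  then have "inv\<^bsub>frac_A\<^esub> ?y \<otimes>\<^bsub>frac_A\<^esub> frac_map a \<in> carrier frac_A"
    "?y \<otimes>\<^bsub>frac_A\<^esub> (inv\<^bsub>frac_A\<^esub> ?y \<otimes>\<^bsub>frac_A\<^esub> frac_map a) = frac_map a"
    by (simp_all add: frac_map_simps(1) flip: F.m_assoc)
  with a y show ?thesis unfolding same_fraction_def by blast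
qed

lemma same_fraction_integral:
  assumes "same_fraction z b"
  shows "integral_over frac_A (to_frac ring_A ` carrier ring_A) z"
proof -
  obtain c d where cd: "chart b ^ 2 + chart (incl_AB c) * chart b + chart (incl_AB d) = 0"
    using chart_quadratic by blast
  have z: "z \<in> carrier frac_A" using assms by (simp add: same_fraction_def)
  note [simp] = frac_map_simps(1) z
  let ?w = "z \<otimes>\<^bsub>frac_A\<^esub> z \<oplus>\<^bsub>frac_A\<^esub> frac_map c \<otimes>\<^bsub>frac_A\<^esub> z \<oplus>\<^bsub>frac_A\<^esub> frac_map d"
  have "same_fraction ?w (b * b + incl_AB c * b + incl_AB d)"
    by (intro same_fraction_add same_fraction_mult same_fraction_frac_map assms)
  moreover have "same_fraction \<zero>\<^bsub>frac_A\<^esub> 0"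
    using same_fraction_frac_map[of 0] by (simp add: frac_map_simps incl_AB.zero)
  moreover have "chart (b * b + incl_AB c * b + incl_AB d) = chart 0"
    using cd by (simp add: chart.hom_simps power2_eq_square)
  ultimately have w: "?w = \<zero>\<^bsub>frac_A\<^esub>"
    using same_fraction_unique by blast
  show ?thesis unfolding integral_over_def
  proof (intro exI conjI)
    let ?p = "[\<one>\<^bsub>frac_A\<^esub>, frac_map c, frac_map d]"
    have "range frac_map \<subseteq> to_frac ring_A ` carrier ring_A"
      by (auto simp: frac_map_def coset_map_simps)
    moreover have "\<one>\<^bsub>frac_A\<^esub> \<in> range frac_map" by (metis frac_map_simps(4) rangeI)
    ultimately show "polynomial\<^bsub>frac_A\<^esub> (to_frac ring_A ` carrier ring_A) ?p"
      by (auto simp: polynomial_def)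
    show "F.eval ?p z = \<zero>\<^bsub>frac_A\<^esub>"
      using w by (simp add: numeral_2_eq_2 F.a_assoc)
  qed simp_all
qed

lemma integral_same_fraction:
  assumes "z \<in> carrier frac_A" "integral_over frac_A (to_frac ring_A ` carrier ring_A) z"
  shows "\<exists>b. same_fraction z b"
proof -
  from assms(1) obtain a q where q: "chartA q \<noteq> 0" "frac_map q \<otimes>\<^bsub>frac_A\<^esub> z = frac_map a"
    by (rule frac_A_cases)
  from integral_equation[OF assms(1) q(2) assms(2)] obtain l
    where "chartA (a ^ length l + q * horner a q l) = 0" by blast
  from integral_fraction_in_B[OF this q(1)] obtain b where "chartA q * chart b = chartA a" by blast
  with assms(1) q show ?thesis unfolding same_fraction_def by blast
qed

lemma carrier_normalization_A: "carrier (normalization ring_A) = {z. \<exists>b. same_fraction z b}"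
  using same_fraction_integral integral_same_fraction
  by (auto simp: normalization_def same_fraction_def)

text \<open>On the normalization \<open>same_fraction\<close> is the graph of a bijection onto \<open>B\<close> that respects the
operations; a representative \<open>b\<close> is chosen arbitrarily, and its class does not depend on the choice.\<close>

theorem mainTheorem7:
  fixes A :: "(var4, 'k::field) mpoly set ring"
    and B :: "(var5, 'k) mpoly set ring"
  assumes "perfect_field TYPE('k)"
    and "A = affine_algebra relations_A"
    and "B = affine_algebra relations_B"
  shows "domain A \<and>
    algebra_isomorphic
      (normalization A) (\<lambda>c. to_frac A (affine_scalar relations_A c))
      B (affine_scalar relations_B)"
proof
  show "domain A" unfolding assms(2) by (rule domain_A)
  define h :: "_ \<Rightarrow> (var5, 'k) mpoly set"
    where "h z = coset_map relations_B (SOME b. same_fraction z b)" for z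
  have h: "h z = coset_map relations_B b" if "same_fraction z b" for z b
  proof -
    have "same_fraction z (SOME b. same_fraction z b)" using that by (rule someI)
    with that show ?thesis using same_fraction_unique by (auto simp: h_def coset_B_eq_iff)
  qed
  have ops: "x \<oplus>\<^bsub>normalization ring_A\<^esub> y = x \<oplus>\<^bsub>frac_A\<^esub> y" "x \<otimes>\<^bsub>normalization ring_A\<^esub> y = x \<otimes>\<^bsub>frac_A\<^esub> y"
    "\<one>\<^bsub>normalization ring_A\<^esub> = frac_map 1" for x y :: "((var4, 'k) mpoly set \<times> (var4, 'k) mpoly set) set"
    by (simp_all add: normalization_def frac_map_simps)
  have "h \<in> ring_iso (normalization ring_A) ring_B"
    unfolding ring_iso_def
  proof (intro CollectI conjI ring_hom_memI)
    fix z z' :: "((var4, 'k) mpoly set \<times> (var4, 'k) mpoly set) set"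
    assume "z \<in> carrier (normalization ring_A)" "z' \<in> carrier (normalization ring_A)"
    then obtain b b' where b: "same_fraction z b" "same_fraction z' b'"
      by (auto simp: carrier_normalization_A)
    show "h z \<in> carrier ring_B" by (simp add: h[OF b(1)] coset_map_simps)
    show "h (z \<otimes>\<^bsub>normalization ring_A\<^esub> z') = h z \<otimes>\<^bsub>ring_B\<^esub> h z'"
      using b same_fraction_mult[OF b] by (simp add: ops h coset_map_simps)
    show "h (z \<oplus>\<^bsub>normalization ring_A\<^esub> z') = h z \<oplus>\<^bsub>ring_B\<^esub> h z'"
      using b same_fraction_add[OF b] by (simp add: ops h coset_map_simps)
  next
    show "h \<one>\<^bsub>normalization ring_A\<^esub> = \<one>\<^bsub>ring_B\<^esub>"
      using h[OF same_fraction_frac_map[of 1]] by (simp add: ops incl_AB.one coset_map_simps)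
    show "bij_betw h (carrier (normalization ring_A)) (carrier ring_B)"
      unfolding bij_betw_def
    proof
      show "inj_on h (carrier (normalization ring_A))"
      proof (rule inj_onI)
        fix z z' :: "((var4, 'k) mpoly set \<times> (var4, 'k) mpoly set) set"
        assume "z \<in> carrier (normalization ring_A)" "z' \<in> carrier (normalization ring_A)"
          and eq: "h z = h z'"
        then obtain b b' where b: "same_fraction z b" "same_fraction z' b'"
          by (auto simp: carrier_normalization_A)
        with eq have "chart b = chart b'" by (simp add: h coset_B_eq_iff)
        then show "z = z'" using same_fraction_unique[OF b] by simp
      qed
      have "\<exists>z. same_fraction z b \<and> coset_map relations_B b = h z" for b :: "(var5, 'k) mpoly"
        using ex_same_fraction h by metis
      then show "h ` carrier (normalization ring_A) = carrier ring_B"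
        by (auto simp: carrier_normalization_A carrier_affine_algebra h image_iff) blast
    qed
  qed
  moreover have "h (to_frac ring_A (affine_scalar relations_A c)) = affine_scalar relations_B c" for c
    using h[OF same_fraction_frac_map[of "Const c"]] by (simp add: affine_scalar_eq frac_map_def)
  ultimately show "algebra_isomorphic (normalization A) (\<lambda>c. to_frac A (affine_scalar relations_A c))
      B (affine_scalar relations_B)"
    unfolding algebra_isomorphic_def assms(2,3) by blast
qed

end
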